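(* Let $n=2^\eta$ with $\eta\ge1$ an integer, let $p>1$ with $p\in\mathbb N$, let $\mu,\nu:G_n\to[0,1]$ be two probability measures on the $n\times n$ unit grid $G_n$ with cyclic boundary conditions, and let $\varepsilon_\mu,\varepsilon_\nu:G_n\to\mathbb{R}$ be independent signed noise measures, each distributed according to the zero-sum Gaussian noise model with parameter $\sigma>0$ described in the context. Then $$\mathbb{E}\big[W_p^{\pm}(\mu+\varepsilon_\mu,\nu+\varepsilon_\nu)\big]\ \le\ \Big(\frac{\sqrt2}{2}\Big)^{1-\frac1p}W_1(\mu,\nu)^{\frac1p}+\frac{\sqrt2}{2}\Big(\frac{4}{\sqrt\pi}\,n\log_2 n+\frac1{\sqrt\pi}\,n\Big)^{\frac1p}\sigma^{\frac1p}.$$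
   Context: $G_n=\{0,\tfrac1n,\dots,\tfrac{n-1}{n}\}^2$ is the $n\times n$ unit pixel grid with cyclic boundary conditions, with ground distance $\mathsf d$ the Euclidean (flat torus) distance $\mathsf d(x,y)=\big(\sum_{i=1}^2\min(|x_i-y_i|,1-|x_i-y_i|)^2\big)^{1/2}$. Functions on $G_n$ are identified with signed measures on $G_n$ (the value at a pixel is its point mass); $a_+=\max(a,0)$, $a_-=\max(-a,0)$ pixelwise. Zero-sum Gaussian noise model: with $m=n^2$, the vector of noise values $(\varepsilon(x))_{x\in G_n}$ is distributed as $\mathcal N(0,\Sigma)$, where $\Sigma$ is the $m\times m$ matrix with diagonal entries $\sigma^2$ and off-diagonal entries $-\sigma^2/(m-1)$. In particular $\sum_x\varepsilon(x)=0$ almost surely. For $p\in\mathbb N$, $p\ge1$, and nonnegative measures $\alpha,\beta$ on $G_n$ of equal total mass, $W_p(\alpha,\beta)=\big(\inf_{\pi}\sum_{x,y}\mathsf d(x,y)^p\pi(x,y)\big)^{1/p}$, where the infimum is over all nonnegative measures $\pi$ on $G_n\times G_n$ with marginals $\alpha,\beta$. For signed measures $\rho,\tau$ on $G_n$ of equal total mass, the signed Wasserstein discrepancy is $W_p^{\pm}(\rho,\tau)=W_p(\rho_++\tau_-,\ \tau_++\rho_-)$. *)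

theory Defs
  imports "HOL-Probability.Probability"
begin

text \<open>Functions on the grid are identified with signed measures; only their values on the grid
  matter.\<close>

type_synonym pixel = "real \<times> real"

definition pixel_grid :: "nat \<Rightarrow> pixel set" where
  "pixel_grid n = (\<lambda>k. real k / real n) ` {..<n} \<times> (\<lambda>k. real k / real n) ` {..<n}"

definition circle_dist :: "real \<Rightarrow> real \<Rightarrow> real" where
  "circle_dist s t = min \<bar>s - t\<bar> (1 - \<bar>s - t\<bar>)"

definition torus_dist :: "pixel \<Rightarrow> pixel \<Rightarrow> real" where
  "torus_dist x y = sqrt ((circle_dist (fst x) (fst y))\<^sup>2 + (circle_dist (snd x) (snd y))\<^sup>2)"

definition couplings ::
  "nat \<Rightarrow> (pixel \<Rightarrow> real) \<Rightarrow> (pixel \<Rightarrow> real) \<Rightarrow> (pixel \<Rightarrow> pixel \<Rightarrow> real) set" where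
  "couplings n \<alpha> \<beta> = {\<pi>.
     (\<forall>x\<in>pixel_grid n. \<forall>y\<in>pixel_grid n. 0 \<le> \<pi> x y) \<and>
     (\<forall>x\<in>pixel_grid n. (\<Sum>y\<in>pixel_grid n. \<pi> x y) = \<alpha> x) \<and>
     (\<forall>y\<in>pixel_grid n. (\<Sum>x\<in>pixel_grid n. \<pi> x y) = \<beta> y)}"

text \<open>Meaningful for nonnegative \<open>\<alpha>\<close>, \<open>\<beta>\<close> of equal total mass on the grid; otherwise
  \<open>couplings n \<alpha> \<beta>\<close> is empty and the value is the unspecified constant
  \<open>(Inf {}) powr (1 / p)\<close>.\<close>

definition wasserstein :: "nat \<Rightarrow> nat \<Rightarrow> (pixel \<Rightarrow> real) \<Rightarrow> (pixel \<Rightarrow> real) \<Rightarrow> real" where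
  "wasserstein n p \<alpha> \<beta> =
     (INF \<pi>\<in>couplings n \<alpha> \<beta>.
        \<Sum>x\<in>pixel_grid n. \<Sum>y\<in>pixel_grid n. torus_dist x y ^ p * \<pi> x y) powr (1 / real p)"

definition signed_wasserstein ::
  "nat \<Rightarrow> nat \<Rightarrow> (pixel \<Rightarrow> real) \<Rightarrow> (pixel \<Rightarrow> real) \<Rightarrow> real" where
  "signed_wasserstein n p \<rho> \<tau> =
     wasserstein n p (\<lambda>x. max (\<rho> x) 0 + max (- \<tau> x) 0) (\<lambda>x. max (\<tau> x) 0 + max (- \<rho> x) 0)"

text \<open>The one-dimensional normal law with mean \<open>m\<close> and variance \<open>v \<ge> 0\<close>, a point mass if
  \<open>v = 0\<close>. (The library's \<open>normal_density\<close> takes the standard deviation.)\<close>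

definition normal_law :: "real \<Rightarrow> real \<Rightarrow> real measure" where
  "normal_law m v =
     (if v = 0 then return borel m else density lborel (\<lambda>x. ennreal (normal_density m (sqrt v) x)))"

text \<open>The random vector \<open>(X i)\<^sub>i\<close>, \<open>i \<in> I\<close> finite, has law \<open>N(m, S)\<close>: every linear combination
  of its entries is normal with the mean and variance prescribed by \<open>m\<close> and \<open>S\<close>. Unlike a
  definition by a joint density this covers singular \<open>S\<close>, such as the zero-sum covariance
  below.\<close>

definition multivariate_normal ::
  "'w measure \<Rightarrow> 'i set \<Rightarrow> ('i \<Rightarrow> 'w \<Rightarrow> real) \<Rightarrow> ('i \<Rightarrow> real) \<Rightarrow> ('i \<Rightarrow> 'i \<Rightarrow> real) \<Rightarrow> bool" where
  "multivariate_normal M I X m S \<longleftrightarrow>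
     (\<forall>i\<in>I. X i \<in> borel_measurable M) \<and>
     (\<forall>t. distr M borel (\<lambda>\<omega>. \<Sum>i\<in>I. t i * X i \<omega>) =
        normal_law (\<Sum>i\<in>I. t i * m i) (\<Sum>i\<in>I. \<Sum>j\<in>I. t i * t j * S i j))"

definition zero_sum_cov :: "nat \<Rightarrow> real \<Rightarrow> pixel \<Rightarrow> pixel \<Rightarrow> real" where
  "zero_sum_cov n \<sigma> x y = (if x = y then \<sigma>\<^sup>2 else - \<sigma>\<^sup>2 / (real (n\<^sup>2) - 1))"

definition zero_sum_gaussian_noise ::
  "'w measure \<Rightarrow> nat \<Rightarrow> real \<Rightarrow> (pixel \<Rightarrow> 'w \<Rightarrow> real) \<Rightarrow> bool" where
  "zero_sum_gaussian_noise M n \<sigma> \<epsilon> \<longleftrightarrow>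
     multivariate_normal M (pixel_grid n) \<epsilon> (\<lambda>_. 0) (zero_sum_cov n \<sigma>)"

end

theory Submission
  imports Defs
begin

text \<open>Distances on the flat torus are at most \<open>D = sqrt 2 / 2\<close>, so a plan of Euclidean cost \<open>c\<close> has
\<open>p\<close>-th power cost at most \<open>D ^ (p - 1) * c\<close>, and everything reduces to transport for the metric
itself. For a metric the cost of moving \<open>\<alpha>\<close> to \<open>\<beta>\<close> is controlled by the difference \<open>\<alpha> - \<beta>\<close>
alone: any flow of mass with that divergence, however it passes through intermediate points, can be
short-cut to a plan between \<open>\<alpha>\<close> and \<open>\<beta>\<close> that is no more expensive (\<open>transport_plan_of_flow\<close>).
For the two measures whose transport defines the signed discrepancy, the difference is \<open>\<mu> - \<nu>\<close>
plus the noise difference \<open>\<delta> = \<epsilon>\<mu> - \<epsilon>\<nu>\<close>. Flows add up, so the cost is at most that of an optimal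
plan from \<open>\<mu>\<close> to \<open>\<nu>\<close> plus that of any flow with divergence \<open>\<delta>\<close> (\<open>optimal_cost_perturbation\<close>).

The flow for \<open>\<delta>\<close> is dyadic. At level \<open>k\<close> the mass of every block of side \<open>2 ^ k\<close> pixels sits at
the corner of the block, and is moved to the corner of the enclosing block of side \<open>2 ^ (k + 1)\<close>,
at distance at most \<open>sqrt 2 * 2 ^ k / n\<close>. At the top level the total mass of \<open>\<delta>\<close>, which is almost
surely zero, is left at one point. The mass of a block is the difference of two independent centred
normal variables of variance at most \<open>\<sigma>\<^sup>2 * 4 ^ k\<close>, because the negative correlations of the noise
only reduce it; its expected absolute value is therefore at most
\<open>2 / sqrt pi * \<sigma> * 2 ^ k\<close>. With \<open>n\<^sup>2 / 4 ^ k\<close> blocks, each of the \<open>log 2 n\<close> levels costs at most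
\<open>2 * sqrt 2 / sqrt pi * \<sigma> * n\<close> in expectation (\<open>dyadic_cost_noise\<close>).

It remains to take the \<open>p\<close>-th root, which is subadditive and concave: the first property separates
the two costs, the second, as a tangent line bound, moves the expectation inside the root.

The expectation only makes sense if the optimal cost is a measurable function of the noise. It is an
infimum over the uncountable set of plans, which moreover varies with the noise. Up to a penalty for
wrong marginals, all nonnegative matrices may compete, and then the countably many rational ones
suffice (\<open>optimal_cost_eq_INF_penalised_cost\<close>).\<close>

section \<open>Transport plans on a finite set\<close>

definition transport_plans ::
  "'a set \<Rightarrow> ('a \<Rightarrow> real) \<Rightarrow> ('a \<Rightarrow> real) \<Rightarrow> ('a \<Rightarrow> 'a \<Rightarrow> real) set" where
  "transport_plans G \<alpha> \<beta> = {\<pi>.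
     (\<forall>x\<in>G. \<forall>y\<in>G. 0 \<le> \<pi> x y) \<and>
     (\<forall>x\<in>G. (\<Sum>y\<in>G. \<pi> x y) = \<alpha> x) \<and>
     (\<forall>y\<in>G. (\<Sum>x\<in>G. \<pi> x y) = \<beta> y)}"

definition transport_cost ::
  "'a set \<Rightarrow> ('a \<Rightarrow> 'a \<Rightarrow> real) \<Rightarrow> ('a \<Rightarrow> 'a \<Rightarrow> real) \<Rightarrow> real" where
  "transport_cost G c \<pi> = (\<Sum>x\<in>G. \<Sum>y\<in>G. c x y * \<pi> x y)"

definition optimal_cost ::
  "'a set \<Rightarrow> ('a \<Rightarrow> 'a \<Rightarrow> real) \<Rightarrow> ('a \<Rightarrow> real) \<Rightarrow> ('a \<Rightarrow> real) \<Rightarrow> real" where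
  "optimal_cost G c \<alpha> \<beta> = (INF \<pi>\<in>transport_plans G \<alpha> \<beta>. transport_cost G c \<pi>)"

lemma transport_plansI:
  assumes "\<And>x y. x \<in> G \<Longrightarrow> y \<in> G \<Longrightarrow> 0 \<le> \<pi> x y"
    and "\<And>x. x \<in> G \<Longrightarrow> (\<Sum>y\<in>G. \<pi> x y) = \<alpha> x"
    and "\<And>y. y \<in> G \<Longrightarrow> (\<Sum>x\<in>G. \<pi> x y) = \<beta> y"
  shows "\<pi> \<in> transport_plans G \<alpha> \<beta>"
  using assms by (simp add: transport_plans_def)

lemma transport_plansD:
  assumes "\<pi> \<in> transport_plans G \<alpha> \<beta>"
  shows "\<And>x y. x \<in> G \<Longrightarrow> y \<in> G \<Longrightarrow> 0 \<le> \<pi> x y"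
    and "\<And>x. x \<in> G \<Longrightarrow> (\<Sum>y\<in>G. \<pi> x y) = \<alpha> x"
    and "\<And>y. y \<in> G \<Longrightarrow> (\<Sum>x\<in>G. \<pi> x y) = \<beta> y"
  using assms by (auto simp: transport_plans_def)

lemma transport_cost_nonneg:
  assumes "\<And>x y. x \<in> G \<Longrightarrow> y \<in> G \<Longrightarrow> 0 \<le> c x y"
    and "\<And>x y. x \<in> G \<Longrightarrow> y \<in> G \<Longrightarrow> 0 \<le> \<pi> x y"
  shows "0 \<le> transport_cost G c \<pi>"
  unfolding transport_cost_def by (intro sum_nonneg mult_nonneg_nonneg assms)

lemma transport_cost_bdd_below:
  assumes "\<And>x y. x \<in> G \<Longrightarrow> y \<in> G \<Longrightarrow> 0 \<le> c x y"
  shows "bdd_below (transport_cost G c ` transport_plans G \<alpha> \<beta>)"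
  by (rule bdd_belowI[where m = 0])
     (auto intro!: transport_cost_nonneg assms dest: transport_plansD(1))

lemma optimal_cost_le:
  assumes "\<And>x y. x \<in> G \<Longrightarrow> y \<in> G \<Longrightarrow> 0 \<le> c x y" and "\<pi> \<in> transport_plans G \<alpha> \<beta>"
  shows "optimal_cost G c \<alpha> \<beta> \<le> transport_cost G c \<pi>"
  unfolding optimal_cost_def using assms by (intro cINF_lower transport_cost_bdd_below)

text \<open>The missing row and column masses have equal totals, so their normalised product fills the gap.\<close>

lemma partial_plan_extends:
  fixes K :: "'a \<Rightarrow> 'a \<Rightarrow> real"
  assumes "finite G"
    and nonneg: "\<And>x y. x \<in> G \<Longrightarrow> y \<in> G \<Longrightarrow> 0 \<le> K x y"
    and rows: "\<And>x. x \<in> G \<Longrightarrow> (\<Sum>y\<in>G. K x y) \<le> \<alpha> x"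
    and cols: "\<And>y. y \<in> G \<Longrightarrow> (\<Sum>x\<in>G. K x y) \<le> \<beta> y"
    and balanced: "sum \<alpha> G = sum \<beta> G"
  obtains \<pi> where "\<pi> \<in> transport_plans G \<alpha> \<beta>"
    and "\<And>x y. x \<in> G \<Longrightarrow> y \<in> G \<Longrightarrow> K x y \<le> \<pi> x y"
    and "(\<Sum>x\<in>G. \<Sum>y\<in>G. \<pi> x y - K x y) = sum \<alpha> G - (\<Sum>x\<in>G. \<Sum>y\<in>G. K x y)"
proof -
  define r where "r x = \<alpha> x - (\<Sum>y\<in>G. K x y)" for x
  define s where "s y = \<beta> y - (\<Sum>x\<in>G. K x y)" for y
  define T where "T = sum r G"
  have r0: "0 \<le> r x" if "x \<in> G" for x using rows[OF that] by (simp add: r_def)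
  have s0: "0 \<le> s x" if "x \<in> G" for x using cols[OF that] by (simp add: s_def)
  have Ts: "T = sum s G"
    unfolding T_def r_def s_def sum_subtractf balanced using sum.swap[of K G G] by simp
  have T0: "0 \<le> T" unfolding T_def by (intro sum_nonneg r0)
  have rT: "r x * T / T = r x" if "x \<in> G" for x
    using that sum_nonneg_eq_0_iff[of G r] r0 \<open>finite G\<close> unfolding T_def by (cases "sum r G = 0") auto
  have sT: "s x * T / T = s x" if "x \<in> G" for x
    using that sum_nonneg_eq_0_iff[of G s] s0 \<open>finite G\<close> unfolding Ts by (cases "sum s G = 0") auto
  define \<pi> where "\<pi> x y = K x y + r x * s y / T" for x y
  have row: "(\<Sum>y\<in>G. \<pi> x y) = \<alpha> x" if "x \<in> G" for x
  proof -
    have "(\<Sum>y\<in>G. \<pi> x y) = (\<Sum>y\<in>G. K x y) + r x * T / T"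
      by (simp add: \<pi>_def sum.distrib Ts sum_distrib_left sum_divide_distrib)
    then show ?thesis using rT[OF that] by (simp add: r_def)
  qed
  have col: "(\<Sum>x\<in>G. \<pi> x y) = \<beta> y" if "y \<in> G" for y
  proof -
    have "(\<Sum>x\<in>G. \<pi> x y) = (\<Sum>x\<in>G. K x y) + s y * T / T"
      by (simp add: \<pi>_def sum.distrib T_def sum_distrib_left sum_divide_distrib mult.commute)
    then show ?thesis using sT[OF that] by (simp add: s_def)
  qed
  have ge: "K x y \<le> \<pi> x y" if "x \<in> G" "y \<in> G" for x y
    using that r0 s0 T0 by (simp add: \<pi>_def)
  show ?thesis
  proof (rule that)
    show "\<pi> \<in> transport_plans G \<alpha> \<beta>"
      using row col by (intro transport_plansI order_trans[OF nonneg ge])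
    show "(\<Sum>x\<in>G. \<Sum>y\<in>G. \<pi> x y - K x y) = sum \<alpha> G - (\<Sum>x\<in>G. \<Sum>y\<in>G. K x y)"
      by (simp add: sum_subtractf row)
  qed (fact ge)
qed

lemma transport_plans_nonempty:
  assumes "finite G" and "\<And>x. x \<in> G \<Longrightarrow> 0 \<le> \<alpha> x" and "\<And>x. x \<in> G \<Longrightarrow> 0 \<le> \<beta> x"
    and "sum \<alpha> G = sum \<beta> G"
  shows "transport_plans G \<alpha> \<beta> \<noteq> {}"
  by (rule partial_plan_extends[of G "\<lambda>_ _. 0" \<alpha> \<beta>]) (use assms in auto)

lemma transport_plans_unbalanced:
  assumes "sum \<alpha> G \<noteq> sum \<beta> G"
  shows "transport_plans G \<alpha> \<beta> = {}"
proof -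
  have "sum \<alpha> G = sum \<beta> G" if "\<pi> \<in> transport_plans G \<alpha> \<beta>" for \<pi>
  proof -
    have "sum \<alpha> G = (\<Sum>x\<in>G. \<Sum>y\<in>G. \<pi> x y)" using transport_plansD(2)[OF that] by simp
    also have "\<dots> = (\<Sum>y\<in>G. \<Sum>x\<in>G. \<pi> x y)" by (rule sum.swap)
    also have "\<dots> = sum \<beta> G" using transport_plansD(3)[OF that] by simp
    finally show ?thesis .
  qed
  with assms show ?thesis by blast
qed

lemma optimal_cost_nonneg:
  assumes "finite G" and "\<And>x y. x \<in> G \<Longrightarrow> y \<in> G \<Longrightarrow> 0 \<le> c x y"
    and "\<And>x. x \<in> G \<Longrightarrow> 0 \<le> \<alpha> x" and "\<And>x. x \<in> G \<Longrightarrow> 0 \<le> \<beta> x"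
    and "sum \<alpha> G = sum \<beta> G"
  shows "0 \<le> optimal_cost G c \<alpha> \<beta>"
  unfolding optimal_cost_def using assms
  by (intro cINF_greatest transport_plans_nonempty transport_cost_nonneg)
     (auto dest: transport_plansD(1))

section \<open>Measurability of the optimal cost\<close>

definition penalised_cost ::
  "'a set \<Rightarrow> ('a \<Rightarrow> 'a \<Rightarrow> real) \<Rightarrow> ('a \<Rightarrow> real) \<Rightarrow> ('a \<Rightarrow> real) \<Rightarrow> ('a \<Rightarrow> 'a \<Rightarrow> real) \<Rightarrow> real" where
  "penalised_cost G c \<alpha> \<beta> K = transport_cost G c K
     + 2 * ((\<Sum>x\<in>G. \<bar>(\<Sum>y\<in>G. K x y) - \<alpha> x\<bar>) + (\<Sum>y\<in>G. \<bar>(\<Sum>x\<in>G. K x y) - \<beta> y\<bar>))"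

text \<open>The penalty is exact. Scaling the rows and columns of \<open>K\<close> that carry too much mass yields a matrix
below \<open>K\<close> that respects both marginals; the mass missing from it is bounded by the marginal errors
of \<open>K\<close>, and transporting it in any way costs at most 1 per unit.\<close>

lemma optimal_cost_le_penalised_cost:
  fixes K :: "'a \<Rightarrow> 'a \<Rightarrow> real"
  assumes "finite G"
    and c: "\<And>x y. x \<in> G \<Longrightarrow> y \<in> G \<Longrightarrow> 0 \<le> c x y" "\<And>x y. x \<in> G \<Longrightarrow> y \<in> G \<Longrightarrow> c x y \<le> 1"
    and \<alpha>: "\<And>x. x \<in> G \<Longrightarrow> 0 \<le> \<alpha> x" and \<beta>: "\<And>x. x \<in> G \<Longrightarrow> 0 \<le> \<beta> x"
    and balanced: "sum \<alpha> G = sum \<beta> G"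
    and K: "\<And>x y. x \<in> G \<Longrightarrow> y \<in> G \<Longrightarrow> 0 \<le> K x y"
  shows "optimal_cost G c \<alpha> \<beta> \<le> penalised_cost G c \<alpha> \<beta> K"
proof -
  define R where "R x = (\<Sum>y\<in>G. K x y)" for x
  define S where "S y = (\<Sum>x\<in>G. K x y)" for y
  define u where "u x = min 1 (\<alpha> x / R x)" for x
  define v where "v y = min 1 (\<beta> y / S y)" for y
  define L where "L x y = K x y * u x * v y" for x y
  have R0: "0 \<le> R x" if "x \<in> G" for x unfolding R_def using that by (intro sum_nonneg K)
  have S0: "0 \<le> S x" if "x \<in> G" for x unfolding S_def using that by (intro sum_nonneg K)
  have u: "0 \<le> u x" "u x \<le> 1" if "x \<in> G" for x
    using that \<alpha> R0 by (auto simp: u_def)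
  have v: "0 \<le> v x" "v x \<le> 1" if "x \<in> G" for x
    using that \<beta> S0 by (auto simp: v_def)
  have L0: "0 \<le> L x y" if "x \<in> G" "y \<in> G" for x y
    using that u v K by (simp add: L_def)
  have LK: "L x y \<le> K x y" if "x \<in> G" "y \<in> G" for x y
    using that u v K by (simp add: L_def mult.assoc mult_left_le mult_le_one)
  have clip: "r * min 1 (a / r) \<le> a" "r * (1 - min 1 (a / r)) \<le> \<bar>r - a\<bar>"
    if "0 \<le> a" "0 \<le> r" for a r :: real
  proof -
    have "r * min 1 (a / r) = min r a"
      using that by (cases "r = 0") (auto simp: min_mult_distrib_left)
    then show "r * min 1 (a / r) \<le> a" "r * (1 - min 1 (a / r)) \<le> \<bar>r - a\<bar>"
      by (auto simp: right_diff_distrib)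
  qed
  have Ru: "R x * u x \<le> \<alpha> x" "R x * (1 - u x) \<le> \<bar>R x - \<alpha> x\<bar>" if "x \<in> G" for x
    unfolding u_def by (rule clip[OF \<alpha>[OF that] R0[OF that]])+
  have Sv: "S x * v x \<le> \<beta> x" "S x * (1 - v x) \<le> \<bar>S x - \<beta> x\<bar>" if "x \<in> G" for x
    unfolding v_def by (rule clip[OF \<beta>[OF that] S0[OF that]])+
  have Lrow: "(\<Sum>y\<in>G. L x y) \<le> \<alpha> x" if "x \<in> G" for x
  proof -
    have "(\<Sum>y\<in>G. L x y) \<le> (\<Sum>y\<in>G. K x y * u x)"
      using that u v K by (intro sum_mono) (simp add: L_def mult_left_le)
    also have "\<dots> = R x * u x" by (simp add: R_def sum_distrib_right)
    finally show ?thesis using Ru(1)[OF that] by simp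
  qed
  have Lcol: "(\<Sum>x\<in>G. L x y) \<le> \<beta> y" if "y \<in> G" for y
  proof -
    have "(\<Sum>x\<in>G. L x y) \<le> (\<Sum>x\<in>G. K x y * v y)"
      using that u v K by (intro sum_mono) (simp add: L_def mult_right_mono mult_left_le)
    also have "\<dots> = S y * v y" by (simp add: S_def sum_distrib_right)
    finally show ?thesis using Sv(1)[OF that] by simp
  qed
  obtain \<pi> where \<pi>: "\<pi> \<in> transport_plans G \<alpha> \<beta>"
    and ge: "\<And>x y. x \<in> G \<Longrightarrow> y \<in> G \<Longrightarrow> L x y \<le> \<pi> x y"
    and mass: "(\<Sum>x\<in>G. \<Sum>y\<in>G. \<pi> x y - L x y) = sum \<alpha> G - (\<Sum>x\<in>G. \<Sum>y\<in>G. L x y)"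
    by (rule partial_plan_extends[OF \<open>finite G\<close> L0 Lrow Lcol balanced]) blast+
  have "transport_cost G c \<pi> \<le> (\<Sum>x\<in>G. \<Sum>y\<in>G. c x y * K x y + (\<pi> x y - L x y))"
    unfolding transport_cost_def
  proof (intro sum_mono)
    fix x y assume xy: "x \<in> G" "y \<in> G"
    have "c x y * (\<pi> x y - L x y) \<le> 1 * (\<pi> x y - L x y)"
      using c(2) ge xy by (intro mult_right_mono) auto
    moreover have "c x y * L x y \<le> c x y * K x y"
      using c(1) LK xy by (intro mult_left_mono) auto
    ultimately show "c x y * \<pi> x y \<le> c x y * K x y + (\<pi> x y - L x y)"
      by (simp add: algebra_simps)
  qed
  also have "\<dots> = transport_cost G c K + (sum \<alpha> G - (\<Sum>x\<in>G. \<Sum>y\<in>G. L x y))"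
    unfolding mass[symmetric] by (simp add: transport_cost_def sum.distrib)
  also have "sum \<alpha> G - (\<Sum>x\<in>G. \<Sum>y\<in>G. L x y)
      = (\<Sum>x\<in>G. \<alpha> x - R x) + (\<Sum>x\<in>G. \<Sum>y\<in>G. K x y - L x y)"
    by (simp add: R_def sum_subtractf)
  also have "(\<Sum>x\<in>G. \<Sum>y\<in>G. K x y - L x y)
      \<le> (\<Sum>x\<in>G. \<Sum>y\<in>G. K x y * (1 - u x) + K x y * (1 - v y))"
  proof (intro sum_mono)
    fix x y assume xy: "x \<in> G" "y \<in> G"
    have "0 \<le> K x y * ((1 - u x) * (1 - v y))"
      using K u v xy by simp
    then show "K x y - L x y \<le> K x y * (1 - u x) + K x y * (1 - v y)"
      by (simp add: L_def algebra_simps)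
  qed
  also have "\<dots> = (\<Sum>x\<in>G. R x * (1 - u x)) + (\<Sum>y\<in>G. S y * (1 - v y))"
    unfolding sum.distrib R_def S_def sum_distrib_right
    using sum.swap[of "\<lambda>x y. K x y * (1 - v y)" G G] by simp
  also have "\<dots> \<le> (\<Sum>x\<in>G. \<bar>R x - \<alpha> x\<bar>) + (\<Sum>y\<in>G. \<bar>S y - \<beta> y\<bar>)"
    by (intro add_mono sum_mono Ru Sv)
  also have "(\<Sum>x\<in>G. \<alpha> x - R x) \<le> (\<Sum>x\<in>G. \<bar>R x - \<alpha> x\<bar>)"
    by (intro sum_mono) auto
  finally have "transport_cost G c \<pi> \<le> transport_cost G c K
      + 2 * (\<Sum>x\<in>G. \<bar>R x - \<alpha> x\<bar>) + (\<Sum>y\<in>G. \<bar>S y - \<beta> y\<bar>)"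
    by simp
  moreover have "0 \<le> (\<Sum>y\<in>G. \<bar>S y - \<beta> y\<bar>)" by (intro sum_nonneg) simp
  ultimately have "transport_cost G c \<pi> \<le> penalised_cost G c \<alpha> \<beta> K"
    unfolding penalised_cost_def R_def S_def by argo
  moreover have "optimal_cost G c \<alpha> \<beta> \<le> transport_cost G c \<pi>"
    using c(1) \<pi> by (rule optimal_cost_le)
  ultimately show ?thesis by simp
qed

text \<open>Fixing the value outside \<open>G \<times> G\<close>, as \<open>PiE\<close> does, makes this set countable when \<open>G\<close> is finite.\<close>

definition rational_matrices :: "'a set \<Rightarrow> ('a \<times> 'a \<Rightarrow> real) set" where
  "rational_matrices G = PiE (G \<times> G) (\<lambda>_. \<rat> \<inter> {0..})"

text \<open>By exactness of the penalty no matrix beats the optimal plan, and every plan is a limit of rational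
matrices along which the penalty tends to zero. Unlike the set of plans, the index set on the right
does not depend on \<open>\<alpha>\<close> and \<open>\<beta>\<close>.\<close>

lemma optimal_cost_eq_INF_penalised_cost:
  assumes "finite G"
    and c: "\<And>x y. x \<in> G \<Longrightarrow> y \<in> G \<Longrightarrow> 0 \<le> c x y" "\<And>x y. x \<in> G \<Longrightarrow> y \<in> G \<Longrightarrow> c x y \<le> 1"
    and \<alpha>: "\<And>x. x \<in> G \<Longrightarrow> 0 \<le> \<alpha> x" and \<beta>: "\<And>x. x \<in> G \<Longrightarrow> 0 \<le> \<beta> x"
    and balanced: "sum \<alpha> G = sum \<beta> G"
  shows "optimal_cost G c \<alpha> \<beta> = (INF K\<in>rational_matrices G. penalised_cost G c \<alpha> \<beta> (curry K))"
proof (rule antisym)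
  have nonempty: "rational_matrices G \<noteq> {}"
  proof -
    have "restrict (\<lambda>_. 0) (G \<times> G) \<in> rational_matrices G" by (simp add: rational_matrices_def)
    then show ?thesis by blast
  qed
  have lower: "optimal_cost G c \<alpha> \<beta> \<le> penalised_cost G c \<alpha> \<beta> (curry K)"
    if "K \<in> rational_matrices G" for K
    using that by (intro optimal_cost_le_penalised_cost assms)
      (auto simp: rational_matrices_def PiE_iff)
  show "optimal_cost G c \<alpha> \<beta> \<le> (INF K\<in>rational_matrices G. penalised_cost G c \<alpha> \<beta> (curry K))"
    by (intro cINF_greatest nonempty lower)
  have bdd: "bdd_below ((\<lambda>K. penalised_cost G c \<alpha> \<beta> (curry K)) ` rational_matrices G)"
    using lower by (auto intro!: bdd_belowI)
  show "(INF K\<in>rational_matrices G. penalised_cost G c \<alpha> \<beta> (curry K)) \<le> optimal_cost G c \<alpha> \<beta>"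
    unfolding optimal_cost_def
  proof (intro cINF_greatest transport_plans_nonempty assms)
    fix \<pi> assume \<pi>: "\<pi> \<in> transport_plans G \<alpha> \<beta>"
    define N where "N = real (card G)"
    have N0: "0 \<le> N" by (simp add: N_def)
    show "(INF K\<in>rational_matrices G. penalised_cost G c \<alpha> \<beta> (curry K)) \<le> transport_cost G c \<pi>"
    proof (rule field_le_epsilon)
      fix e :: real assume "0 < e"
      \<comment> \<open>Rounding up by at most \<open>d\<close> adds \<open>N\<^sup>2 * d\<close> to the cost, and as much to each of the two
        marginal errors, which count twice: together \<open>5 * N\<^sup>2 * d\<close>. The summand 1 covers \<open>N = 0\<close>.\<close>
      define d where "d = e / (5 * N\<^sup>2 + 1)"
      have "0 < d" using \<open>0 < e\<close> by (simp add: d_def add_nonneg_pos)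
      have de: "5 * N\<^sup>2 * d \<le> e"
      proof -
        have "5 * N\<^sup>2 * d \<le> (5 * N\<^sup>2 + 1) * d" using \<open>0 < d\<close> by (intro mult_right_mono) auto
        also have "\<dots> = e" by (simp add: d_def add_nonneg_eq_0_iff)
        finally show ?thesis .
      qed
      define q where "q x y = (SOME r. r \<in> \<rat> \<and> \<pi> x y < r \<and> r < \<pi> x y + d)" for x y
      have "\<exists>r. r \<in> \<rat> \<and> \<pi> x y < r \<and> r < \<pi> x y + d" for x y
        using Rats_dense_in_real[of "\<pi> x y" "\<pi> x y + d"] \<open>0 < d\<close> by auto
      then have "q x y \<in> \<rat> \<and> \<pi> x y < q x y \<and> q x y < \<pi> x y + d" for x y
        unfolding q_def by (rule someI_ex)
      then have q: "q x y \<in> \<rat>" "\<pi> x y < q x y" "q x y < \<pi> x y + d" for x y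
        by simp_all
      have qd: "\<bar>q x y - \<pi> x y\<bar> \<le> d" for x y
        using q(2)[of x y] q(3)[of x y] by linarith
      define K where "K = restrict (case_prod q) (G \<times> G)"
      have Kin: "K \<in> rational_matrices G"
      proof -
        have "0 \<le> q x y" if "x \<in> G" "y \<in> G" for x y
          using q(2)[of x y] transport_plansD(1)[OF \<pi> that] by simp
        then show ?thesis using q(1) by (auto simp: rational_matrices_def K_def)
      qed
      have Kq: "curry K x y = q x y" if "x \<in> G" "y \<in> G" for x y
        using that by (simp add: K_def)
      have "transport_cost G c (curry K) \<le> (\<Sum>x\<in>G. \<Sum>y\<in>G. c x y * \<pi> x y + d)"
        unfolding transport_cost_def
      proof (intro sum_mono)
        fix x y assume xy: "x \<in> G" "y \<in> G"
        have "c x y * q x y \<le> c x y * (\<pi> x y + d)"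
          using c(1) xy q(3)[of x y] by (intro mult_left_mono) auto
        also have "\<dots> \<le> c x y * \<pi> x y + d"
          using c(2)[OF xy] \<open>0 < d\<close> by (simp add: algebra_simps mult_left_le)
        finally show "c x y * curry K x y \<le> c x y * \<pi> x y + d" using Kq xy by simp
      qed
      also have "\<dots> = transport_cost G c \<pi> + N\<^sup>2 * d"
        by (simp add: transport_cost_def sum.distrib N_def power2_eq_square)
      finally have 1: "transport_cost G c (curry K) \<le> transport_cost G c \<pi> + N\<^sup>2 * d" .
      have "\<bar>(\<Sum>y\<in>G. curry K x y) - \<alpha> x\<bar> \<le> N * d" if "x \<in> G" for x
      proof -
        have "\<bar>(\<Sum>y\<in>G. curry K x y) - \<alpha> x\<bar> = \<bar>\<Sum>y\<in>G. q x y - \<pi> x y\<bar>"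
          using Kq that transport_plansD(2)[OF \<pi>] by (simp add: sum_subtractf)
        also have "\<dots> \<le> (\<Sum>y\<in>G. d)"
          by (intro order_trans[OF sum_abs] sum_mono qd)
        finally show ?thesis by (simp add: N_def)
      qed
      then have "(\<Sum>x\<in>G. \<bar>(\<Sum>y\<in>G. curry K x y) - \<alpha> x\<bar>) \<le> (\<Sum>x\<in>G. N * d)" by (rule sum_mono)
      then have 2: "(\<Sum>x\<in>G. \<bar>(\<Sum>y\<in>G. curry K x y) - \<alpha> x\<bar>) \<le> N\<^sup>2 * d"
        by (simp add: N_def power2_eq_square mult.assoc)
      have "\<bar>(\<Sum>x\<in>G. curry K x y) - \<beta> y\<bar> \<le> N * d" if "y \<in> G" for y
      proof -
        have "\<bar>(\<Sum>x\<in>G. curry K x y) - \<beta> y\<bar> = \<bar>\<Sum>x\<in>G. q x y - \<pi> x y\<bar>"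
          using Kq that transport_plansD(3)[OF \<pi>] by (simp add: sum_subtractf)
        also have "\<dots> \<le> (\<Sum>x\<in>G. d)"
          by (intro order_trans[OF sum_abs] sum_mono qd)
        finally show ?thesis by (simp add: N_def)
      qed
      then have "(\<Sum>y\<in>G. \<bar>(\<Sum>x\<in>G. curry K x y) - \<beta> y\<bar>) \<le> (\<Sum>y\<in>G. N * d)" by (rule sum_mono)
      then have 3: "(\<Sum>y\<in>G. \<bar>(\<Sum>x\<in>G. curry K x y) - \<beta> y\<bar>) \<le> N\<^sup>2 * d"
        by (simp add: N_def power2_eq_square mult.assoc)
      have "(INF K\<in>rational_matrices G. penalised_cost G c \<alpha> \<beta> (curry K))
          \<le> penalised_cost G c \<alpha> \<beta> (curry K)"
        using bdd Kin by (rule cINF_lower)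
      also have "\<dots> \<le> transport_cost G c \<pi> + 5 * N\<^sup>2 * d"
        using 1 2 3 by (simp add: penalised_cost_def)
      also have "\<dots> \<le> transport_cost G c \<pi> + e" using de by simp
      finally show "(INF K\<in>rational_matrices G. penalised_cost G c \<alpha> \<beta> (curry K))
          \<le> transport_cost G c \<pi> + e" .
    qed
  qed
qed

lemma countable_rational_matrices:
  assumes "finite G" shows "countable (rational_matrices G)"
  unfolding rational_matrices_def using assms
  by (intro countable_PiE) (auto intro: countable_Int1 countable_rat)

lemma borel_measurable_optimal_cost:
  fixes \<alpha> \<beta> :: "'w \<Rightarrow> 'a \<Rightarrow> real"
  assumes "finite G"
    and c: "\<And>x y. x \<in> G \<Longrightarrow> y \<in> G \<Longrightarrow> 0 \<le> c x y" "\<And>x y. x \<in> G \<Longrightarrow> y \<in> G \<Longrightarrow> c x y \<le> 1"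
    and \<alpha>: "\<And>\<omega> x. x \<in> G \<Longrightarrow> 0 \<le> \<alpha> \<omega> x" and \<beta>: "\<And>\<omega> x. x \<in> G \<Longrightarrow> 0 \<le> \<beta> \<omega> x"
    and [measurable]: "\<And>x. x \<in> G \<Longrightarrow> (\<lambda>\<omega>. \<alpha> \<omega> x) \<in> borel_measurable M"
      "\<And>x. x \<in> G \<Longrightarrow> (\<lambda>\<omega>. \<beta> \<omega> x) \<in> borel_measurable M"
  shows "(\<lambda>\<omega>. optimal_cost G c (\<alpha> \<omega>) (\<beta> \<omega>)) \<in> borel_measurable M"
proof -
  let ?pen = "\<lambda>K \<omega>. penalised_cost G c (\<alpha> \<omega>) (\<beta> \<omega>) (curry K)"
  have meas: "?pen K \<in> borel_measurable M" for K
    unfolding penalised_cost_def by measurable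
  have "(\<lambda>\<omega>. INF K\<in>rational_matrices G. ?pen K \<omega>) \<in> borel_measurable M"
    using countable_rational_matrices[OF \<open>finite G\<close>] meas by (intro borel_measurable_cINF_real) auto
  \<comment> \<open>If the total masses differ, there are no plans and the infimum is a constant.\<close>
  moreover have "optimal_cost G c (\<alpha> \<omega>) (\<beta> \<omega>) =
      (if sum (\<alpha> \<omega>) G = sum (\<beta> \<omega>) G then INF K\<in>rational_matrices G. ?pen K \<omega> else Inf {})" for \<omega>
  proof (cases "sum (\<alpha> \<omega>) G = sum (\<beta> \<omega>) G")
    case True
    then show ?thesis
      using optimal_cost_eq_INF_penalised_cost[of G c "\<alpha> \<omega>" "\<beta> \<omega>"] assms by simp
  next
    case False
    then show ?thesis
      by (simp add: optimal_cost_def transport_plans_unbalanced)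
  qed
  ultimately show ?thesis by simp
qed

section \<open>From flows to transport plans\<close>

text \<open>Mass \<open>c\<close> that arrives at \<open>v\<close> and leaves it again is sent directly from its origins to its
destinations. Origins and destinations are matched proportionally: row and column \<open>v\<close> shrink by the
factors \<open>1 - c / a\<close> and \<open>1 - c / b\<close>, and the product of the two removed parts, normalised, is added
elsewhere. By the triangle inequality the detour through \<open>v\<close> cost at least as much. If \<open>v\<close> kept
mass of its own, the two reductions could make the entry at \<open>(v, v)\<close> negative, whence the
assumption on it.\<close>

lemma bypass_point:
  fixes d \<pi> :: "'a \<Rightarrow> 'a \<Rightarrow> real"
  assumes "finite G" "v \<in> G" and \<pi>: "\<pi> \<in> transport_plans G \<alpha> \<beta>"
    and tri: "\<And>x y. x \<in> G \<Longrightarrow> y \<in> G \<Longrightarrow> d x y \<le> d x v + d v y"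
    and "\<pi> v v = 0" and c: "0 < c" "c \<le> \<alpha> v" "c \<le> \<beta> v"
  obtains \<pi>' where "\<pi>' \<in> transport_plans G (\<alpha>(v := \<alpha> v - c)) (\<beta>(v := \<beta> v - c))"
    and "transport_cost G d \<pi>' \<le> transport_cost G d \<pi>"
proof -
  define a b where "a = \<alpha> v" and "b = \<beta> v"
  have ab: "0 < a" "0 < b" "c / a \<le> 1" "c / b \<le> 1" using c by (auto simp: a_def b_def)
  note \<pi>D = transport_plansD[OF \<pi>]
  have row_v: "(\<Sum>y\<in>G. \<pi> v y) = a" and col_v: "(\<Sum>x\<in>G. \<pi> x v) = b"
    using \<pi>D(2,3) \<open>v \<in> G\<close> by (simp_all add: a_def b_def)
  have row_scaled: "(\<Sum>y\<in>G. t * \<pi> v y) = t * a" and col_scaled: "(\<Sum>x\<in>G. t * \<pi> x v) = t * b" for t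
    by (simp_all only: sum_distrib_left[symmetric] row_v col_v)
  define \<pi>' where "\<pi>' x y = \<pi> x y - (if x = v then c / a * \<pi> v y else 0)
      - (if y = v then c / b * \<pi> x v else 0) + c / (a * b) * \<pi> x v * \<pi> v y" for x y
  show ?thesis
  proof (rule that[of \<pi>'], rule transport_plansI)
    fix x y assume xy: "x \<in> G" "y \<in> G"
    have "c / a * \<pi> v y \<le> 1 * \<pi> v y" "c / b * \<pi> x v \<le> 1 * \<pi> x v"
      using ab xy \<pi>D(1) \<open>v \<in> G\<close> by (intro mult_right_mono; simp)+
    moreover have "0 \<le> c / (a * b) * \<pi> x v * \<pi> v y"
      using ab c xy \<pi>D(1) \<open>v \<in> G\<close> by simp
    ultimately show "0 \<le> \<pi>' x y"
      using \<pi>D(1)[OF xy] \<open>\<pi> v v = 0\<close> unfolding \<pi>'_def by auto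
  next
    fix x assume "x \<in> G"
    have "(\<Sum>y\<in>G. if x = v then c / a * \<pi> v y else 0) = (if x = v then c else 0)"
      using ab row_scaled[of "c / a"] by simp
    moreover have "(\<Sum>y\<in>G. if y = v then c / b * \<pi> x v else 0) = c / b * \<pi> x v"
      using \<open>finite G\<close> \<open>v \<in> G\<close> by simp
    moreover have "(\<Sum>y\<in>G. c / (a * b) * \<pi> x v * \<pi> v y) = c / b * \<pi> x v"
      using ab by (simp only: row_scaled) simp
    ultimately show "(\<Sum>y\<in>G. \<pi>' x y) = (\<alpha>(v := \<alpha> v - c)) x"
      using \<pi>D(2)[OF \<open>x \<in> G\<close>] unfolding \<pi>'_def sum.distrib sum_subtractf by simp
  next
    fix y assume "y \<in> G"
    have "(\<Sum>x\<in>G. if x = v then c / a * \<pi> v y else 0) = c / a * \<pi> v y"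
      using \<open>finite G\<close> \<open>v \<in> G\<close> by simp
    moreover have "(\<Sum>x\<in>G. if y = v then c / b * \<pi> x v else 0) = (if y = v then c else 0)"
      using ab col_scaled[of "c / b"] by simp
    moreover have "(\<Sum>x\<in>G. c / (a * b) * \<pi> x v * \<pi> v y) = c / a * \<pi> v y"
    proof -
      have "(\<Sum>x\<in>G. c / (a * b) * \<pi> x v * \<pi> v y) = (\<Sum>x\<in>G. c / (a * b) * \<pi> v y * \<pi> x v)"
        by (simp add: mult_ac)
      then show ?thesis using ab by (simp only: col_scaled) simp
    qed
    ultimately show "(\<Sum>x\<in>G. \<pi>' x y) = (\<beta>(v := \<beta> v - c)) y"
      using \<pi>D(3)[OF \<open>y \<in> G\<close>] unfolding \<pi>'_def sum.distrib sum_subtractf by simp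
  next
    define P where "P = (\<Sum>y\<in>G. d v y * \<pi> v y)"
    define Q where "Q = (\<Sum>x\<in>G. d x v * \<pi> x v)"
    define Z where "Z = (\<Sum>x\<in>G. \<Sum>y\<in>G. d x y * (\<pi> x v * \<pi> v y))"
    have "Z \<le> (\<Sum>x\<in>G. \<Sum>y\<in>G. (d x v + d v y) * (\<pi> x v * \<pi> v y))"
      unfolding Z_def using tri \<pi>D(1) \<open>v \<in> G\<close> by (intro sum_mono mult_right_mono) auto
    also have "\<dots> = (\<Sum>x\<in>G. \<Sum>y\<in>G. d x v * \<pi> x v * \<pi> v y) + (\<Sum>x\<in>G. \<Sum>y\<in>G. \<pi> x v * (d v y * \<pi> v y))"
      by (simp add: sum.distrib[symmetric] algebra_simps)
    also have "\<dots> = Q * a + b * P"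
      by (simp add: Q_def P_def sum_product row_v[symmetric] col_v[symmetric])
    finally have Z: "Z \<le> Q * a + b * P" .
    have "d x y * \<pi>' x y = d x y * \<pi> x y - (if x = v then c / a * (d v y * \<pi> v y) else 0)
        - (if y = v then c / b * (d x v * \<pi> x v) else 0)
        + c / (a * b) * (d x y * (\<pi> x v * \<pi> v y))" for x y
      by (simp add: \<pi>'_def algebra_simps)
    then have "transport_cost G d \<pi>' = transport_cost G d \<pi>
        - (\<Sum>x\<in>G. \<Sum>y\<in>G. if x = v then c / a * (d v y * \<pi> v y) else 0)
        - (\<Sum>x\<in>G. \<Sum>y\<in>G. if y = v then c / b * (d x v * \<pi> x v) else 0)
        + (\<Sum>x\<in>G. \<Sum>y\<in>G. c / (a * b) * (d x y * (\<pi> x v * \<pi> v y)))"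
      by (simp only: transport_cost_def sum.distrib sum_subtractf)
    moreover have "(\<Sum>x\<in>G. \<Sum>y\<in>G. if x = v then c / a * (d v y * \<pi> v y) else 0) = c / a * P"
    proof -
      have "(\<Sum>y\<in>G. if x = v then c / a * (d v y * \<pi> v y) else 0) = (if x = v then c / a * P else 0)" for x
        by (simp add: P_def sum_distrib_left)
      then show ?thesis using \<open>finite G\<close> \<open>v \<in> G\<close> by simp
    qed
    moreover have "(\<Sum>x\<in>G. \<Sum>y\<in>G. if y = v then c / b * (d x v * \<pi> x v) else 0) = c / b * Q"
      using \<open>finite G\<close> \<open>v \<in> G\<close> by (simp add: Q_def sum_distrib_left)
    moreover have "(\<Sum>x\<in>G. \<Sum>y\<in>G. c / (a * b) * (d x y * (\<pi> x v * \<pi> v y))) = c / (a * b) * Z"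
      by (simp only: Z_def sum_distrib_left)
    ultimately have "transport_cost G d \<pi>' = transport_cost G d \<pi> - c / a * P - c / b * Q + c / (a * b) * Z"
      by simp
    also have "\<dots> \<le> transport_cost G d \<pi> - c / a * P - c / b * Q + c / (a * b) * (Q * a + b * P)"
      using Z ab c by (intro add_left_mono mult_left_mono) auto
    also have "\<dots> = transport_cost G d \<pi>"
      using ab by (simp add: field_simps)
    finally show "transport_cost G d \<pi>' \<le> transport_cost G d \<pi>" .
  qed
qed

text \<open>Mass that stays at \<open>v\<close> costs nothing and is cancelled first; only when this is not enough is the
diagonal entry zero, and then the rest can bypass \<open>v\<close>.\<close>

lemma remove_common_mass_at:
  fixes d \<pi> :: "'a \<Rightarrow> 'a \<Rightarrow> real"
  assumes "finite G" "v \<in> G" and \<pi>: "\<pi> \<in> transport_plans G \<alpha> \<beta>"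
    and "d v v = 0" and tri: "\<And>x y. x \<in> G \<Longrightarrow> y \<in> G \<Longrightarrow> d x y \<le> d x v + d v y"
    and c: "0 \<le> c" "c \<le> \<alpha> v" "c \<le> \<beta> v"
  obtains \<pi>' where "\<pi>' \<in> transport_plans G (\<alpha>(v := \<alpha> v - c)) (\<beta>(v := \<beta> v - c))"
    and "transport_cost G d \<pi>' \<le> transport_cost G d \<pi>"
proof -
  note \<pi>D = transport_plansD[OF \<pi>]
  define q where "q = min c (\<pi> v v)"
  define \<rho> where "\<rho> x y = \<pi> x y - (if x = v then if y = v then q else 0 else 0)" for x y
  have \<rho>: "\<rho> \<in> transport_plans G (\<alpha>(v := \<alpha> v - q)) (\<beta>(v := \<beta> v - q))"
  proof (rule transport_plansI)
    show "0 \<le> \<rho> x y" if "x \<in> G" "y \<in> G" for x y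
      using \<pi>D(1)[OF that] by (auto simp: \<rho>_def q_def)
    show "(\<Sum>y\<in>G. \<rho> x y) = (\<alpha>(v := \<alpha> v - q)) x" if "x \<in> G" for x
      using \<pi>D(2)[OF that] \<open>finite G\<close> \<open>v \<in> G\<close> by (simp add: \<rho>_def sum_subtractf sum.delta)
    show "(\<Sum>x\<in>G. \<rho> x y) = (\<beta>(v := \<beta> v - q)) y" if "y \<in> G" for y
      using \<pi>D(3)[OF that] \<open>finite G\<close> \<open>v \<in> G\<close> by (simp add: \<rho>_def sum_subtractf sum.delta)
  qed
  have "d x y * \<rho> x y = d x y * \<pi> x y" for x y
    using \<open>d v v = 0\<close> by (simp add: \<rho>_def)
  then have cost: "transport_cost G d \<rho> = transport_cost G d \<pi>"
    by (simp only: transport_cost_def)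
  show ?thesis
  proof (cases "q = c")
    case True
    then show ?thesis using \<rho> cost by (intro that[of \<rho>]) auto
  next
    case False
    then have "q < c" "\<rho> v v = 0" by (auto simp: q_def \<rho>_def)
    then obtain \<pi>' where "\<pi>' \<in> transport_plans G
        ((\<alpha>(v := \<alpha> v - q))(v := (\<alpha>(v := \<alpha> v - q)) v - (c - q)))
        ((\<beta>(v := \<beta> v - q))(v := (\<beta>(v := \<beta> v - q)) v - (c - q)))"
      and "transport_cost G d \<pi>' \<le> transport_cost G d \<rho>"
      using bypass_point[OF \<open>finite G\<close> \<open>v \<in> G\<close> \<rho>, of d "c - q"] tri c by auto
    then show ?thesis using cost by (intro that[of \<pi>']) auto
  qed
qed

text \<open>For a metric cost, mass common to source and target is of no help: adding \<open>r\<close> to both sides does not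
make transport cheaper. The points carrying common mass are treated one after the other.\<close>

lemma remove_common_mass:
  fixes d \<pi> :: "'a \<Rightarrow> 'a \<Rightarrow> real"
  assumes "finite G"
    and d0: "\<And>x. x \<in> G \<Longrightarrow> d x x = 0"
    and tri: "\<And>x y z. x \<in> G \<Longrightarrow> y \<in> G \<Longrightarrow> z \<in> G \<Longrightarrow> d x z \<le> d x y + d y z"
    and \<alpha>: "\<And>x. x \<in> G \<Longrightarrow> 0 \<le> \<alpha> x" and \<beta>: "\<And>x. x \<in> G \<Longrightarrow> 0 \<le> \<beta> x"
    and r: "\<And>x. x \<in> G \<Longrightarrow> 0 \<le> r x"
    and \<pi>: "\<pi> \<in> transport_plans G (\<lambda>x. \<alpha> x + r x) (\<lambda>x. \<beta> x + r x)"
  obtains \<pi>' where "\<pi>' \<in> transport_plans G \<alpha> \<beta>"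
    and "transport_cost G d \<pi>' \<le> transport_cost G d \<pi>"
proof -
  have "\<exists>\<pi>'\<in>transport_plans G \<alpha> \<beta>. transport_cost G d \<pi>' \<le> transport_cost G d \<pi>"
    if "finite S" "S \<subseteq> G" "\<And>x. x \<in> G \<Longrightarrow> 0 \<le> r x" "\<And>x. x \<in> G - S \<Longrightarrow> r x = 0"
      "\<pi> \<in> transport_plans G (\<lambda>x. \<alpha> x + r x) (\<lambda>x. \<beta> x + r x)" for S r \<pi>
    using that
  proof (induction S arbitrary: r \<pi> rule: finite_induct)
    case empty
    then have "\<pi> \<in> transport_plans G \<alpha> \<beta>" by (simp add: transport_plans_def)
    then show ?case by auto
  next
    case (insert v S)
    let ?r = "r(v := 0)"
    have "v \<in> G" using insert by simp
    obtain \<pi>1 where \<pi>1: "\<pi>1 \<in> transport_plans G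
        ((\<lambda>x. \<alpha> x + r x)(v := \<alpha> v + r v - r v)) ((\<lambda>x. \<beta> x + r x)(v := \<beta> v + r v - r v))"
      and le: "transport_cost G d \<pi>1 \<le> transport_cost G d \<pi>"
      by (rule remove_common_mass_at[OF \<open>finite G\<close> \<open>v \<in> G\<close> insert.prems(4), of d "r v"])
         (use \<open>v \<in> G\<close> d0 tri \<alpha> \<beta> insert.prems in auto)
    have "(\<lambda>x. \<alpha> x + r x)(v := \<alpha> v + r v - r v) = (\<lambda>x. \<alpha> x + ?r x)"
      "(\<lambda>x. \<beta> x + r x)(v := \<beta> v + r v - r v) = (\<lambda>x. \<beta> x + ?r x)" by auto
    with \<pi>1 have "\<pi>1 \<in> transport_plans G (\<lambda>x. \<alpha> x + ?r x) (\<lambda>x. \<beta> x + ?r x)" by simp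
    moreover have "S \<subseteq> G" "\<And>x. x \<in> G \<Longrightarrow> 0 \<le> ?r x" "\<And>x. x \<in> G - S \<Longrightarrow> ?r x = 0"
      using insert.prems by auto
    ultimately have "\<exists>\<pi>'\<in>transport_plans G \<alpha> \<beta>. transport_cost G d \<pi>' \<le> transport_cost G d \<pi>1"
      by (intro insert.IH)
    then show ?case using le by (meson order_trans)
  qed
  from this[OF \<open>finite G\<close> order_refl r _ \<pi>] that show ?thesis by auto
qed

text \<open>A flow \<open>F\<close> with divergence \<open>f\<close>, as in Beckmann's formulation of optimal transport: mass may be
passed on through intermediate points.\<close>

definition flow_bound :: "'a set \<Rightarrow> ('a \<Rightarrow> 'a \<Rightarrow> real) \<Rightarrow> ('a \<Rightarrow> real) \<Rightarrow> real \<Rightarrow> bool" where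
  "flow_bound G d f C \<longleftrightarrow> (\<exists>F. (\<forall>x\<in>G. \<forall>y\<in>G. 0 \<le> F x y) \<and>
     (\<forall>x\<in>G. f x = (\<Sum>y\<in>G. F x y) - (\<Sum>y\<in>G. F y x)) \<and> transport_cost G d F \<le> C)"

lemma flow_boundI:
  assumes "\<And>x y. x \<in> G \<Longrightarrow> y \<in> G \<Longrightarrow> 0 \<le> F x y"
    and "\<And>x. x \<in> G \<Longrightarrow> f x = (\<Sum>y\<in>G. F x y) - (\<Sum>y\<in>G. F y x)"
    and "transport_cost G d F \<le> C"
  shows "flow_bound G d f C"
  using assms unfolding flow_bound_def by blast

lemma flow_bound_cong:
  assumes "flow_bound G d f C" and "\<And>x. x \<in> G \<Longrightarrow> f x = g x"
  shows "flow_bound G d g C"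
  using assms by (simp add: flow_bound_def)

lemma flow_bound_plan:
  assumes "\<pi> \<in> transport_plans G \<alpha> \<beta>"
  shows "flow_bound G d (\<lambda>x. \<alpha> x - \<beta> x) (transport_cost G d \<pi>)"
  by (rule flow_boundI[where F = \<pi>]) (use transport_plansD[OF assms] in auto)

lemma flow_bound_add:
  assumes "flow_bound G d f C" and "flow_bound G d g D"
  shows "flow_bound G d (\<lambda>x. f x + g x) (C + D)"
proof -
  obtain F H where
    F: "\<forall>x\<in>G. \<forall>y\<in>G. 0 \<le> F x y" "\<forall>x\<in>G. f x = (\<Sum>y\<in>G. F x y) - (\<Sum>y\<in>G. F y x)"
      "transport_cost G d F \<le> C" and
    H: "\<forall>x\<in>G. \<forall>y\<in>G. 0 \<le> H x y" "\<forall>x\<in>G. g x = (\<Sum>y\<in>G. H x y) - (\<Sum>y\<in>G. H y x)"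
      "transport_cost G d H \<le> D"
    using assms unfolding flow_bound_def by blast
  have "transport_cost G d (\<lambda>x y. F x y + H x y) = transport_cost G d F + transport_cost G d H"
    by (simp add: transport_cost_def sum.distrib distrib_left)
  then show ?thesis
    using F H by (intro flow_boundI[where F = "\<lambda>x y. F x y + H x y"]) (auto simp: sum.distrib)
qed

lemma flow_bound_sum:
  assumes "finite I" and "\<And>i. i \<in> I \<Longrightarrow> flow_bound G d (f i) (C i)"
  shows "flow_bound G d (\<lambda>x. \<Sum>i\<in>I. f i x) (\<Sum>i\<in>I. C i)"
  using assms
proof (induction I rule: finite_induct)
  case empty
  show ?case by (rule flow_boundI[where F = "\<lambda>_ _. 0"]) (auto simp: transport_cost_def)
next
  case (insert i I)
  then show ?case using flow_bound_add[of G d "f i" "C i"] by auto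
qed

lemma flow_bound_move:
  assumes "finite G" "a \<in> G" "b \<in> G" and "d b a = d a b"
  shows "flow_bound G d (\<lambda>x. (if a = x then w else 0) - (if b = x then w else 0)) (\<bar>w\<bar> * d a b)"
proof -
  have *: "flow_bound G d (\<lambda>x. (if a = x then w else 0) - (if b = x then w else 0)) (w * d a b)"
    if "a \<in> G" "b \<in> G" "0 \<le> w" for a b and w :: real
  proof (rule flow_boundI[where F = "\<lambda>x y. if a = x then if b = y then w else 0 else 0"])
    have "transport_cost G d (\<lambda>x y. if a = x then if b = y then w else 0 else 0)
        = (\<Sum>x\<in>G. \<Sum>y\<in>G. if a = x then if b = y then w * d x y else 0 else 0)"
      unfolding transport_cost_def by (intro sum.cong refl) auto
    also have "\<dots> = w * d a b"
      using \<open>finite G\<close> that by (simp add: sum.delta if_distrib[of "\<lambda>f. sum f G"] sum.If_cases)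
    finally show "transport_cost G d (\<lambda>x y. if a = x then if b = y then w else 0 else 0) \<le> w * d a b"
      by simp
  qed (use \<open>finite G\<close> that in \<open>auto simp: sum.delta\<close>)
  show ?thesis
  proof (cases "0 \<le> w")
    case True
    then show ?thesis using *[of a b w] assms by simp
  next
    case False
    then have "flow_bound G d (\<lambda>x. (if b = x then - w else 0) - (if a = x then - w else 0)) (\<bar>w\<bar> * d a b)"
      using *[of b a "- w"] assms by simp
    then show ?thesis by (rule flow_bound_cong) auto
  qed
qed

text \<open>A flow is a transport plan between its outgoing and its incoming mass at each point, which differ
from \<open>\<alpha>\<close> and \<open>\<beta>\<close> by a common function once some idle mass has been put on the diagonal.\<close>

lemma transport_plan_of_flow:
  fixes d :: "'a \<Rightarrow> 'a \<Rightarrow> real"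
  assumes "finite G"
    and d0: "\<And>x. x \<in> G \<Longrightarrow> d x x = 0"
    and tri: "\<And>x y z. x \<in> G \<Longrightarrow> y \<in> G \<Longrightarrow> z \<in> G \<Longrightarrow> d x z \<le> d x y + d y z"
    and \<alpha>: "\<And>x. x \<in> G \<Longrightarrow> 0 \<le> \<alpha> x" and \<beta>: "\<And>x. x \<in> G \<Longrightarrow> 0 \<le> \<beta> x"
    and "flow_bound G d (\<lambda>x. \<alpha> x - \<beta> x) C"
  obtains \<pi> where "\<pi> \<in> transport_plans G \<alpha> \<beta>" and "transport_cost G d \<pi> \<le> C"
proof -
  obtain F where F: "\<And>x y. x \<in> G \<Longrightarrow> y \<in> G \<Longrightarrow> 0 \<le> F x y"
      "\<And>x. x \<in> G \<Longrightarrow> \<alpha> x - \<beta> x = (\<Sum>y\<in>G. F x y) - (\<Sum>y\<in>G. F y x)"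
      "transport_cost G d F \<le> C"
    using assms(6) unfolding flow_bound_def by blast
  \<comment> \<open>The rows of \<open>F'\<close> sum to \<open>\<alpha> + r\<close> by definition, its columns to \<open>\<beta> + r\<close> by the
    divergence equation; the diagonal term makes \<open>r\<close> nonnegative.\<close>
  define r where "r x = (\<Sum>y\<in>G. F x y) + \<beta> x" for x
  define F' where "F' x y = F x y + (if x = y then \<alpha> x + \<beta> x else 0)" for x y
  have F': "F' \<in> transport_plans G (\<lambda>x. \<alpha> x + r x) (\<lambda>x. \<beta> x + r x)"
  proof (rule transport_plansI)
    show "0 \<le> F' x y" if "x \<in> G" "y \<in> G" for x y
      using that F(1) \<alpha> \<beta> by (simp add: F'_def)
    show "(\<Sum>y\<in>G. F' x y) = \<alpha> x + r x" if "x \<in> G" for x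
      using that \<open>finite G\<close> by (simp add: F'_def r_def sum.distrib)
    show "(\<Sum>x\<in>G. F' x y) = \<beta> y + r y" if "y \<in> G" for y
      using that \<open>finite G\<close> F(2)[OF that] by (simp add: F'_def r_def sum.distrib)
  qed
  have r0: "0 \<le> r x" if "x \<in> G" for x
    using that by (auto simp: r_def intro!: add_nonneg_nonneg sum_nonneg F(1) \<beta>)
  obtain \<pi> where "\<pi> \<in> transport_plans G \<alpha> \<beta>" "transport_cost G d \<pi> \<le> transport_cost G d F'"
    by (rule remove_common_mass[where d = d, OF \<open>finite G\<close> d0 tri \<alpha> \<beta> r0 F'])
  moreover have "transport_cost G d F' = transport_cost G d F"
    unfolding transport_cost_def F'_def using d0 by (intro sum.cong refl) simp
  ultimately show ?thesis using F(3) that by simp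
qed

text \<open>Level \<open>k\<close> moves the mass that \<open>f\<close> has on each fibre of \<open>g k\<close> from its representative to the next
coarser one, which turns the push-forward of \<open>f\<close> under \<open>g k\<close> into the one under \<open>g (Suc k)\<close>.
The divergences telescope, from \<open>f\<close> itself to its total mass placed at \<open>r\<close>, which is zero.\<close>

lemma flow_bound_hierarchy:
  fixes d :: "'a \<Rightarrow> 'a \<Rightarrow> real" and f :: "'a \<Rightarrow> real" and g :: "nat \<Rightarrow> 'a \<Rightarrow> 'a"
  assumes "finite G"
    and sym: "\<And>x y. x \<in> G \<Longrightarrow> y \<in> G \<Longrightarrow> d x y = d y x"
    and g: "\<And>k x. x \<in> G \<Longrightarrow> g k x \<in> G"
    and nested: "\<And>k x. x \<in> G \<Longrightarrow> g (Suc k) (g k x) = g (Suc k) x"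
    and bottom: "\<And>x. x \<in> G \<Longrightarrow> g 0 x = x"
    and top: "\<And>x. x \<in> G \<Longrightarrow> g m x = r"
    and total: "sum f G = 0"
  shows "flow_bound G d f (\<Sum>k<m. \<Sum>u\<in>g k ` G. \<bar>\<Sum>z | z \<in> G \<and> g k z = u. f z\<bar> * d u (g (Suc k) u))"
proof -
  define h where "h k u = (\<Sum>z | z \<in> G \<and> g k z = u. f z)" for k u
  have h: "h k x = (\<Sum>z\<in>G. if g k z = x then f z else 0)" for k x
    unfolding h_def using \<open>finite G\<close> by (simp add: sum.inter_filter)
  have level: "flow_bound G d (\<lambda>x. h k x - h (Suc k) x) (\<Sum>u\<in>g k ` G. \<bar>h k u\<bar> * d u (g (Suc k) u))"
    for k
  proof -
    have "flow_bound G d (\<lambda>x. \<Sum>u\<in>g k ` G. (if u = x then h k u else 0) - (if g (Suc k) u = x then h k u else 0))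
       (\<Sum>u\<in>g k ` G. \<bar>h k u\<bar> * d u (g (Suc k) u))"
      using \<open>finite G\<close> g sym by (intro flow_bound_sum flow_bound_move) auto
    then show ?thesis
    proof (rule flow_bound_cong)
      fix x assume "x \<in> G"
      have group: "(\<Sum>z\<in>G. t z) = (\<Sum>u\<in>g k ` G. \<Sum>z | z \<in> G \<and> g k z = u. t z)" for t :: "'a \<Rightarrow> real"
        using \<open>finite G\<close> by (rule sum.image_gen)
      have "(\<Sum>u\<in>g k ` G. if u = x then h k u else 0) = h k x"
        unfolding h[of k x] group[of "\<lambda>z. if g k z = x then f z else 0"]
        by (intro sum.cong refl) (auto simp: h_def)
      moreover have "(\<Sum>u\<in>g k ` G. if g (Suc k) u = x then h k u else 0) = h (Suc k) x"
        unfolding h[of "Suc k" x] group[of "\<lambda>z. if g (Suc k) z = x then f z else 0"]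
      proof (intro sum.cong refl)
        fix u
        have "g (Suc k) z = g (Suc k) u" if "z \<in> G" "g k z = u" for z
          using nested that by metis
        then show "(if g (Suc k) u = x then h k u else 0)
            = (\<Sum>z | z \<in> G \<and> g k z = u. if g (Suc k) z = x then f z else 0)"
          by (auto simp: h_def)
      qed
      ultimately show "(\<Sum>u\<in>g k ` G. (if u = x then h k u else 0) - (if g (Suc k) u = x then h k u else 0))
          = h k x - h (Suc k) x"
        by (simp add: sum_subtractf)
    qed
  qed
  have "flow_bound G d (\<lambda>x. \<Sum>k<m. h k x - h (Suc k) x)
      (\<Sum>k<m. \<Sum>u\<in>g k ` G. \<bar>h k u\<bar> * d u (g (Suc k) u))"
    by (intro flow_bound_sum level) simp
  then show ?thesis unfolding h_def[symmetric]
  proof (rule flow_bound_cong)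
    fix x assume "x \<in> G"
    have "(\<Sum>k<m. h k x - h (Suc k) x) = h 0 x - h m x" by (rule sum_lessThan_telescope')
    also have "h 0 x = f x"
      unfolding h using \<open>finite G\<close> \<open>x \<in> G\<close> by (simp add: bottom cong: sum.cong)
    also have "h m x = 0"
      unfolding h using total by (cases "r = x") (simp_all add: top cong: sum.cong)
    finally show "(\<Sum>k<m. h k x - h (Suc k) x) = f x" by simp
  qed
qed

section \<open>Torus distance and dyadic blocks of pixels\<close>

lemma circle_dist_self: "circle_dist s s = 0"
  by (simp add: circle_dist_def)

lemma circle_dist_commute: "circle_dist s t = circle_dist t s"
  by (simp add: circle_dist_def abs_minus_commute)

lemma circle_dist_le_half: "circle_dist s t \<le> 1 / 2"
  by (simp add: circle_dist_def min_def field_simps)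

lemma circle_dist_le_abs: "circle_dist s t \<le> \<bar>s - t\<bar>"
  by (simp add: circle_dist_def)

lemma circle_dist_nonneg:
  assumes "s \<in> {0..1}" "t \<in> {0..1}"
  shows "0 \<le> circle_dist s t"
  using assms by (auto simp: circle_dist_def)

lemma circle_dist_triangle:
  assumes "s \<in> {0..1}" "t \<in> {0..1}" "u \<in> {0..1}"
  shows "circle_dist s u \<le> circle_dist s t + circle_dist t u"
  using assms unfolding circle_dist_def by (auto simp: min_def abs_if)

lemma torus_dist_self: "torus_dist x x = 0"
  by (simp add: torus_dist_def circle_dist_self)

lemma torus_dist_commute: "torus_dist x y = torus_dist y x"
  by (simp add: torus_dist_def circle_dist_commute)

lemma torus_dist_nonneg: "0 \<le> torus_dist x y"
  by (simp add: torus_dist_def)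

lemma torus_dist_le:
  assumes "x \<in> {0..1} \<times> {0..1}" "y \<in> {0..1} \<times> {0..1}"
    and "circle_dist (fst x) (fst y) \<le> r" "circle_dist (snd x) (snd y) \<le> r"
  shows "torus_dist x y \<le> sqrt 2 * r"
proof -
  have 0: "0 \<le> circle_dist (fst x) (fst y)" "0 \<le> circle_dist (snd x) (snd y)"
    using assms by (auto intro!: circle_dist_nonneg)
  have "torus_dist x y \<le> sqrt (r\<^sup>2 + r\<^sup>2)"
    unfolding torus_dist_def
    using 0 assms(3,4) by (intro real_sqrt_le_mono add_mono power_mono)
  also have "\<dots> = sqrt 2 * r"
    using 0 assms(3) by (simp add: real_sqrt_mult flip: mult_2)
  finally show ?thesis .
qed

lemma torus_dist_triangle:
  assumes "x \<in> {0..1} \<times> {0..1}" "y \<in> {0..1} \<times> {0..1}" "z \<in> {0..1} \<times> {0..1}"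
  shows "torus_dist x z \<le> torus_dist x y + torus_dist y z"
proof -
  have "torus_dist x z \<le> sqrt ((circle_dist (fst x) (fst y) + circle_dist (fst y) (fst z))\<^sup>2
      + (circle_dist (snd x) (snd y) + circle_dist (snd y) (snd z))\<^sup>2)"
    unfolding torus_dist_def using assms
    by (intro real_sqrt_le_mono add_mono power_mono circle_dist_triangle circle_dist_nonneg) auto
  also have "\<dots> \<le> torus_dist x y + torus_dist y z"
    unfolding torus_dist_def by (rule real_sqrt_sum_squares_triangle_ineq)
  finally show ?thesis .
qed

definition grid_axis :: "nat \<Rightarrow> real set" where
  "grid_axis n = (\<lambda>k. real k / real n) ` {..<n}"

lemma pixel_grid_eq: "pixel_grid n = grid_axis n \<times> grid_axis n"
  by (simp add: pixel_grid_def grid_axis_def)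

lemma finite_pixel_grid: "finite (pixel_grid n)"
  by (simp add: pixel_grid_def)

lemma card_pixel_grid: "card (pixel_grid n) = n\<^sup>2"
proof -
  have "card (grid_axis n) = n"
    unfolding grid_axis_def by (subst card_image) (auto simp: inj_on_def field_simps)
  then show ?thesis by (simp add: pixel_grid_eq card_cartesian_product power2_eq_square)
qed

lemma pixel_grid_subset_unit_square: "x \<in> pixel_grid n \<Longrightarrow> x \<in> {0..1} \<times> {0..1}"
  by (auto simp: pixel_grid_def)

lemma torus_dist_le_diameter:
  assumes "x \<in> pixel_grid n" "y \<in> pixel_grid n"
  shows "torus_dist x y \<le> sqrt 2 / 2"
  using torus_dist_le[OF assms[THEN pixel_grid_subset_unit_square] circle_dist_le_half circle_dist_le_half]
  by simp

text \<open>Rounds the pixel index down to a multiple of \<open>2 ^ k\<close>. It is defined on coordinates, so that it can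
be iterated without choosing indices for pixels.\<close>

definition snap :: "nat \<Rightarrow> nat \<Rightarrow> real \<Rightarrow> real" where
  "snap n k s = real (nat \<lfloor>s * real n\<rfloor> div 2 ^ k * 2 ^ k) / real n"

definition snap_pixel :: "nat \<Rightarrow> nat \<Rightarrow> pixel \<Rightarrow> pixel" where
  "snap_pixel n k x = (snap n k (fst x), snap n k (snd x))"

lemma snap_axis:
  assumes "i < n" shows "snap n k (real i / real n) = real (i div 2 ^ k * 2 ^ k) / real n"
proof -
  have "real i / real n * real n = real i" using assms by simp
  then show ?thesis unfolding snap_def by simp
qed

lemma snap_in_axis:
  assumes "s \<in> grid_axis n" shows "snap n k s \<in> grid_axis n"
proof -
  obtain i where i: "i < n" "s = real i / real n" using assms by (auto simp: grid_axis_def)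
  have "i div 2 ^ k * 2 ^ k \<le> i" by simp
  then have "i div 2 ^ k * 2 ^ k < n" using i(1) by (rule le_less_trans)
  then show ?thesis unfolding i(2) snap_axis[OF i(1)] grid_axis_def by blast
qed

lemma snap_snap_Suc:
  assumes "s \<in> grid_axis n" shows "snap n (Suc k) (snap n k s) = snap n (Suc k) s"
proof -
  obtain i where i: "i < n" "s = real i / real n" using assms by (auto simp: grid_axis_def)
  have "i div 2 ^ k * 2 ^ k \<le> i" by simp
  then have less: "i div 2 ^ k * 2 ^ k < n" using i(1) by (rule le_less_trans)
  have "i div 2 ^ k * 2 ^ k div 2 ^ Suc k = i div 2 ^ Suc k"
    unfolding power_Suc2 div_mult2_eq by simp
  then show ?thesis unfolding i(2) snap_axis[OF i(1)] snap_axis[OF less] by simp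
qed

lemma snap_Suc_dist:
  assumes "s \<in> grid_axis n" shows "\<bar>snap n k s - snap n (Suc k) s\<bar> \<le> 2 ^ k / real n"
proof -
  obtain i where i: "i < n" "s = real i / real n" using assms by (auto simp: grid_axis_def)
  define q where "q = i div 2 ^ k"
  have "i div 2 ^ Suc k = q div 2" unfolding power_Suc2 div_mult2_eq q_def ..
  moreover have "real q = real (q div 2) * 2 + real (q mod 2)"
    by (metis div_mult_mod_eq of_nat_add of_nat_mult of_nat_numeral)
  ultimately have "snap n k s - snap n (Suc k) s = real (q mod 2) * 2 ^ k / real n"
    unfolding i(2) snap_axis[OF i(1)] q_def[symmetric]
    by (simp add: algebra_simps add_divide_distrib)
  moreover have "real (q mod 2) * 2 ^ k \<le> 1 * 2 ^ k"
    by (intro mult_right_mono) auto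
  ultimately show ?thesis by (simp add: divide_right_mono)
qed

lemma snap_bottom: "s \<in> grid_axis n \<Longrightarrow> snap n 0 s = s"
  by (auto simp: grid_axis_def snap_axis)

lemma snap_top: "s \<in> grid_axis (2 ^ \<eta>) \<Longrightarrow> snap (2 ^ \<eta>) \<eta> s = 0"
  unfolding grid_axis_def by (auto simp: snap_axis simp del: of_nat_power)

lemma card_snap_image_le:
  assumes "k \<le> \<eta>" shows "card (snap (2 ^ \<eta>) k ` grid_axis (2 ^ \<eta>)) \<le> 2 ^ (\<eta> - k)"
proof -
  let ?n = "2 ^ \<eta> :: nat"
  have "snap ?n k ` grid_axis ?n \<subseteq> (\<lambda>q. real (q * 2 ^ k) / real ?n) ` {..<2 ^ (\<eta> - k)}"
  proof (clarify)
    fix s assume "s \<in> grid_axis ?n"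
    then obtain i where i: "i < ?n" "s = real i / real ?n" by (auto simp: grid_axis_def)
    have "(2::nat) ^ \<eta> = 2 ^ (\<eta> - k) * 2 ^ k" using assms by (simp flip: power_add)
    then have "i div 2 ^ k < 2 ^ (\<eta> - k)"
      using i(1) by (simp add: less_mult_imp_div_less)
    then show "snap ?n k s \<in> (\<lambda>q. real (q * 2 ^ k) / real ?n) ` {..<2 ^ (\<eta> - k)}"
      unfolding i(2) snap_axis[OF i(1)] by blast
  qed
  then have "card (snap ?n k ` grid_axis ?n) \<le> card {..<(2::nat) ^ (\<eta> - k)}"
    by (rule surj_card_le[rotated]) simp
  then show ?thesis by simp
qed

lemma card_snap_fiber_le: "card {s \<in> grid_axis n. snap n k s = t} \<le> 2 ^ k"
proof (cases "{s \<in> grid_axis n. snap n k s = t} = {}")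
  case False
  then obtain j where j: "j < n" "t = real (j div 2 ^ k * 2 ^ k) / real n"
    by (auto simp: grid_axis_def snap_axis)
  define b where "b = j div 2 ^ k"
  have "{s \<in> grid_axis n. snap n k s = t} \<subseteq> (\<lambda>i. real i / real n) ` {b * 2 ^ k..<b * 2 ^ k + 2 ^ k}"
  proof clarify
    fix s assume "s \<in> grid_axis n" "t = snap n k s"
    then obtain i where i: "i < n" "s = real i / real n" by (auto simp: grid_axis_def)
    have "real (i div 2 ^ k * 2 ^ k) / real n = real (b * 2 ^ k) / real n"
      using \<open>t = snap n k s\<close> unfolding i(2) snap_axis[OF i(1)] j(2) b_def ..
    then have "real (i div 2 ^ k * 2 ^ k) = real (b * 2 ^ k)" using i(1) by simp
    then have "i div 2 ^ k * 2 ^ k = b * 2 ^ k" by (simp only: of_nat_eq_iff)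
    moreover have "i = i div 2 ^ k * 2 ^ k + i mod 2 ^ k" by (rule div_mult_mod_eq[symmetric])
    moreover have "i mod 2 ^ k < 2 ^ k" by simp
    ultimately have "i \<in> {b * 2 ^ k..<b * 2 ^ k + 2 ^ k}"
      unfolding atLeastLessThan_iff by linarith
    then show "s \<in> (\<lambda>i. real i / real n) ` {b * 2 ^ k..<b * 2 ^ k + 2 ^ k}"
      unfolding i(2) by blast
  qed
  then have "card {s \<in> grid_axis n. snap n k s = t} \<le> card {b * 2 ^ k..<b * 2 ^ k + 2 ^ k}"
    by (rule surj_card_le[rotated]) simp
  then show ?thesis by simp
next
  case True
  then show ?thesis by (simp only: card.empty)
qed

lemma snap_pixel_in_grid: "x \<in> pixel_grid n \<Longrightarrow> snap_pixel n k x \<in> pixel_grid n"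
  by (auto simp: pixel_grid_eq snap_pixel_def snap_in_axis)

lemma snap_pixel_Suc_snap_pixel:
  "x \<in> pixel_grid n \<Longrightarrow> snap_pixel n (Suc k) (snap_pixel n k x) = snap_pixel n (Suc k) x"
  by (auto simp: pixel_grid_eq snap_pixel_def snap_snap_Suc)

lemma snap_pixel_bottom: "x \<in> pixel_grid n \<Longrightarrow> snap_pixel n 0 x = x"
  by (auto simp: pixel_grid_eq snap_pixel_def snap_bottom)

lemma snap_pixel_top: "x \<in> pixel_grid (2 ^ \<eta>) \<Longrightarrow> snap_pixel (2 ^ \<eta>) \<eta> x = (0, 0)"
  by (auto simp: pixel_grid_eq snap_pixel_def snap_top)

lemma card_snap_pixel_image_le:
  assumes "k \<le> \<eta>"
  shows "card (snap_pixel (2 ^ \<eta>) k ` pixel_grid (2 ^ \<eta>)) \<le> 4 ^ (\<eta> - k)"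
proof -
  let ?A = "snap (2 ^ \<eta>) k ` grid_axis (2 ^ \<eta>)"
  have "finite ?A" by (simp add: grid_axis_def)
  have "card (snap_pixel (2 ^ \<eta>) k ` pixel_grid (2 ^ \<eta>)) \<le> card (?A \<times> ?A)"
    using \<open>finite ?A\<close> by (intro card_mono) (auto simp: pixel_grid_eq snap_pixel_def)
  also have "\<dots> \<le> 2 ^ (\<eta> - k) * 2 ^ (\<eta> - k)"
    unfolding card_cartesian_product by (intro mult_le_mono card_snap_image_le assms)
  finally show ?thesis by (simp flip: power_mult_distrib)
qed

lemma card_snap_pixel_fiber_le: "card {x. x \<in> pixel_grid n \<and> snap_pixel n k x = u} \<le> 4 ^ k"
proof -
  have "{x. x \<in> pixel_grid n \<and> snap_pixel n k x = u}
      = {s \<in> grid_axis n. snap n k s = fst u} \<times> {s \<in> grid_axis n. snap n k s = snd u}"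
    by (auto simp: pixel_grid_eq snap_pixel_def)
  then have "card {x. x \<in> pixel_grid n \<and> snap_pixel n k x = u} \<le> 2 ^ k * 2 ^ k"
    by (simp add: card_cartesian_product mult_le_mono card_snap_fiber_le)
  then show ?thesis by (simp flip: power_mult_distrib)
qed

lemma torus_dist_snap_pixel_Suc_le:
  assumes "u \<in> snap_pixel n k ` pixel_grid n"
  shows "torus_dist u (snap_pixel n (Suc k) u) \<le> sqrt 2 * (2 ^ k / real n)"
proof -
  obtain x where x: "x \<in> pixel_grid n" and u: "u = snap_pixel n k x" using assms by blast
  have "fst x \<in> grid_axis n" "snd x \<in> grid_axis n" using x by (auto simp: pixel_grid_eq)
  note close = this[THEN snap_Suc_dist, THEN order_trans[OF circle_dist_le_abs]]
  have "torus_dist (snap_pixel n k x) (snap_pixel n (Suc k) x) \<le> sqrt 2 * (2 ^ k / real n)"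
    using x close
    by (intro torus_dist_le pixel_grid_subset_unit_square[of _ n] snap_pixel_in_grid) (simp_all add: snap_pixel_def)
  then show ?thesis unfolding u using x by (simp add: snap_pixel_Suc_snap_pixel)
qed

section \<open>Noise of a block of pixels\<close>

text \<open>Among the pairs of pixels of \<open>Q\<close>, the diagonal ones contribute \<open>card Q * \<sigma>\<^sup>2\<close> and the others are
negatively correlated, so that the variance vanishes again when \<open>Q\<close> is the whole grid.\<close>

lemma block_covariance:
  assumes "Q \<subseteq> pixel_grid n" "1 < n"
  shows "(\<Sum>x\<in>pixel_grid n. \<Sum>y\<in>pixel_grid n.
      (if x \<in> Q then 1 else 0) * (if y \<in> Q then 1 else 0) * zero_sum_cov n \<sigma> x y)
    = \<sigma>\<^sup>2 * real (card Q) * (real (n\<^sup>2) - real (card Q)) / (real (n\<^sup>2) - 1)"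
proof -
  let ?G = "pixel_grid n" and ?m = "real (n\<^sup>2)"
  \<comment> \<open>The covariance matrix is \<open>e\<close> in all entries plus \<open>\<sigma>\<^sup>2 - e\<close> on the diagonal.\<close>
  define e where "e = - \<sigma>\<^sup>2 / (?m - 1)"
  have "1 < n\<^sup>2" using \<open>1 < n\<close> by (simp add: power2_eq_square one_less_mult)
  then have "1 < ?m" by (metis of_nat_1 of_nat_less_iff)
  then have m: "?m - 1 \<noteq> 0" by simp
  have "finite Q" using assms(1) finite_pixel_grid by (rule finite_subset)
  have "(\<Sum>x\<in>?G. \<Sum>y\<in>?G. (if x \<in> Q then 1 else 0) * (if y \<in> Q then 1 else 0) * zero_sum_cov n \<sigma> x y)
      = (\<Sum>x\<in>Q. \<Sum>y\<in>?G. (if y \<in> Q then 1 else 0) * zero_sum_cov n \<sigma> x y)"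
    using assms(1) finite_pixel_grid by (intro sum.mono_neutral_cong_right) auto
  also have "\<dots> = (\<Sum>x\<in>Q. \<Sum>y\<in>Q. zero_sum_cov n \<sigma> x y)"
    using assms(1) finite_pixel_grid by (intro sum.cong refl sum.mono_neutral_cong_right) auto
  also have "\<dots> = (\<Sum>x\<in>Q. \<Sum>y\<in>Q. e + (if x = y then \<sigma>\<^sup>2 - e else 0))"
    by (intro sum.cong refl) (simp add: zero_sum_cov_def e_def)
  also have "\<dots> = real (card Q) * (real (card Q) * e + (\<sigma>\<^sup>2 - e))"
    using \<open>finite Q\<close> by (simp add: sum.distrib)
  also have "\<dots> = \<sigma>\<^sup>2 * real (card Q) * (?m - real (card Q)) / (?m - 1)"
    using m unfolding e_def by (simp add: divide_simps) (simp add: algebra_simps)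
  finally show ?thesis .
qed

lemma distr_block_sum:
  assumes "zero_sum_gaussian_noise M n \<sigma> \<epsilon>" "Q \<subseteq> pixel_grid n" "1 < n"
  shows "distr M borel (\<lambda>\<omega>. \<Sum>x\<in>Q. \<epsilon> x \<omega>)
    = normal_law 0 (\<sigma>\<^sup>2 * real (card Q) * (real (n\<^sup>2) - real (card Q)) / (real (n\<^sup>2) - 1))"
proof -
  let ?t = "\<lambda>x. if x \<in> Q then 1 else 0 :: real"
  have "distr M borel (\<lambda>\<omega>. \<Sum>x\<in>pixel_grid n. ?t x * \<epsilon> x \<omega>)
      = normal_law (\<Sum>x\<in>pixel_grid n. ?t x * 0)
         (\<Sum>x\<in>pixel_grid n. \<Sum>y\<in>pixel_grid n. ?t x * ?t y * zero_sum_cov n \<sigma> x y)"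
    by (rule assms(1)[unfolded zero_sum_gaussian_noise_def multivariate_normal_def, THEN conjunct2,
          THEN spec, of ?t])
  moreover have "(\<Sum>x\<in>pixel_grid n. ?t x * \<epsilon> x \<omega>) = (\<Sum>x\<in>Q. \<epsilon> x \<omega>)" for \<omega>
    using assms(2) finite_pixel_grid by (intro sum.mono_neutral_cong_right) auto
  ultimately show ?thesis by (simp add: block_covariance[OF assms(2,3)])
qed

lemma measurable_noise:
  assumes "zero_sum_gaussian_noise M n \<sigma> \<epsilon>" "x \<in> pixel_grid n"
  shows "\<epsilon> x \<in> borel_measurable M"
  using assms unfolding zero_sum_gaussian_noise_def multivariate_normal_def by blast

lemma AE_noise_sum_zero:
  assumes "zero_sum_gaussian_noise M n \<sigma> \<epsilon>" "1 < n"
  shows "AE \<omega> in M. (\<Sum>x\<in>pixel_grid n. \<epsilon> x \<omega>) = 0"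
proof -
  have meas: "(\<lambda>\<omega>. \<Sum>x\<in>pixel_grid n. \<epsilon> x \<omega>) \<in> borel_measurable M"
    using measurable_noise[OF assms(1)] by simp
  have law: "distr M borel (\<lambda>\<omega>. \<Sum>x\<in>pixel_grid n. \<epsilon> x \<omega>) = return borel 0"
    using distr_block_sum[OF assms(1) order_refl assms(2)]
    by (simp add: card_pixel_grid normal_law_def)
  have "AE s in distr M borel (\<lambda>\<omega>. \<Sum>x\<in>pixel_grid n. \<epsilon> x \<omega>). s = 0"
    unfolding law by (simp add: AE_return)
  then show ?thesis using meas by (simp add: AE_distr_iff)
qed

lemma (in prob_space) indep_normal_abs_diff:
  assumes indep: "indep_var borel X borel Y" and v: "0 < v"
    and X: "distr M borel X = normal_law 0 v" and Y: "distr M borel Y = normal_law 0 v"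
  shows "integrable M (\<lambda>\<omega>. \<bar>X \<omega> - Y \<omega>\<bar>)"
    and "expectation (\<lambda>\<omega>. \<bar>X \<omega> - Y \<omega>\<bar>) = 2 / sqrt pi * sqrt v"
proof -
  have normal: "distributed M lborel Z (normal_density 0 (sqrt v))"
    if "Z \<in> borel_measurable M" "distr M borel Z = normal_law 0 v" for Z
  proof -
    have "distr M lborel Z = distr M borel Z" by (rule distr_cong) simp_all
    then show ?thesis using that v by (simp add: distributed_def normal_law_def)
  qed
  have D: "distributed M lborel (\<lambda>\<omega>. X \<omega> - Y \<omega>) (normal_density 0 (sqrt (2 * v)))"
    using diff_indep_normal[OF indep _ _ normal[OF _ X] normal[OF _ Y]]
      indep_var_rv1[OF indep] indep_var_rv2[OF indep] v by simp
  have moment: "has_bochner_integral lborel (\<lambda>x. normal_density 0 (sqrt (2 * v)) x * \<bar>x\<bar>) (2 / sqrt pi * sqrt v)"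
    using normal_moment_abs_odd[of "sqrt (2 * v)" 0 0] v
    by (simp add: real_sqrt_mult real_sqrt_divide mult_ac)
  show "integrable M (\<lambda>\<omega>. \<bar>X \<omega> - Y \<omega>\<bar>)"
    using distributed_integrable[OF D, of abs] moment by (simp add: has_bochner_integral_iff)
  show "expectation (\<lambda>\<omega>. \<bar>X \<omega> - Y \<omega>\<bar>) = 2 / sqrt pi * sqrt v"
    using distributed_integral[OF D, of abs] moment by (simp add: has_bochner_integral_iff)
qed

text \<open>The bound is the value for independent pixels; correlations only decrease the variance. A nonempty
\<open>Q\<close> short of the whole grid has positive variance, so that the noise of \<open>Q\<close> has a density.\<close>

lemma (in prob_space) block_noise_difference:
  assumes noise: "zero_sum_gaussian_noise M n \<sigma> \<epsilon>\<mu>" "zero_sum_gaussian_noise M n \<sigma> \<epsilon>\<nu>"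
    and indep: "indep_var (PiM (pixel_grid n) (\<lambda>_. borel)) (\<lambda>\<omega>. \<lambda>x\<in>pixel_grid n. \<epsilon>\<mu> x \<omega>)
           (PiM (pixel_grid n) (\<lambda>_. borel)) (\<lambda>\<omega>. \<lambda>x\<in>pixel_grid n. \<epsilon>\<nu> x \<omega>)"
    and "0 < \<sigma>" "1 < n" and Q: "Q \<subseteq> pixel_grid n" "card Q < n\<^sup>2"
  shows "integrable M (\<lambda>\<omega>. \<bar>\<Sum>x\<in>Q. \<epsilon>\<mu> x \<omega> - \<epsilon>\<nu> x \<omega>\<bar>)"
    and "expectation (\<lambda>\<omega>. \<bar>\<Sum>x\<in>Q. \<epsilon>\<mu> x \<omega> - \<epsilon>\<nu> x \<omega>\<bar>) \<le> 2 / sqrt pi * \<sigma> * sqrt (card Q)"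
proof -
  let ?X = "\<lambda>\<omega>. \<Sum>x\<in>Q. \<epsilon>\<mu> x \<omega>" and ?Y = "\<lambda>\<omega>. \<Sum>x\<in>Q. \<epsilon>\<nu> x \<omega>"
  have "integrable M (\<lambda>\<omega>. \<bar>?X \<omega> - ?Y \<omega>\<bar>) \<and>
      expectation (\<lambda>\<omega>. \<bar>?X \<omega> - ?Y \<omega>\<bar>) \<le> 2 / sqrt pi * \<sigma> * sqrt (card Q)"
  proof (cases "Q = {}")
    case False
    have "finite Q" using Q(1) finite_pixel_grid by (rule finite_subset)
    define s where "s = real (card Q)"
    define v where "v = \<sigma>\<^sup>2 * s * (real (n\<^sup>2) - s) / (real (n\<^sup>2) - 1)"
    have s: "1 \<le> s" "s < real (n\<^sup>2)"
      using False \<open>finite Q\<close> Q(2) card_gt_0_iff[of Q] by (auto simp: s_def simp del: of_nat_power)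
    have "0 < v" using s \<open>0 < \<sigma>\<close> unfolding v_def by (intro divide_pos_pos mult_pos_pos) auto
    have "v = (\<sigma>\<^sup>2 * s) * ((real (n\<^sup>2) - s) / (real (n\<^sup>2) - 1))" by (simp add: v_def)
    also have "\<dots> \<le> \<sigma>\<^sup>2 * s" using s by (intro mult_left_le) auto
    finally have "sqrt v \<le> sqrt (\<sigma>\<^sup>2 * s)" by (rule real_sqrt_le_mono)
    then have sv: "sqrt v \<le> \<sigma> * sqrt (card Q)" using \<open>0 < \<sigma>\<close> by (simp add: real_sqrt_mult s_def)
    have [measurable]: "(\<lambda>f. \<Sum>x\<in>Q. f x) \<in> borel_measurable (PiM (pixel_grid n) (\<lambda>_. borel :: real measure))"
      using Q(1) by (intro borel_measurable_sum measurable_component_singleton) auto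
    have "indep_var borel ((\<lambda>f. \<Sum>x\<in>Q. f x) \<circ> (\<lambda>\<omega>. \<lambda>x\<in>pixel_grid n. \<epsilon>\<mu> x \<omega>))
        borel ((\<lambda>f. \<Sum>x\<in>Q. f x) \<circ> (\<lambda>\<omega>. \<lambda>x\<in>pixel_grid n. \<epsilon>\<nu> x \<omega>))"
      by (rule indep_var_compose[OF indep]) measurable
    moreover have "(\<lambda>f. \<Sum>x\<in>Q. f x) \<circ> (\<lambda>\<omega>. \<lambda>x\<in>pixel_grid n. \<epsilon> x \<omega>) = (\<lambda>\<omega>. \<Sum>x\<in>Q. \<epsilon> x \<omega>)"
      for \<epsilon> :: "pixel \<Rightarrow> 'a \<Rightarrow> real"
      using Q(1) by (auto simp: fun_eq_iff intro!: sum.cong)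
    ultimately have "indep_var borel ?X borel ?Y" by simp
    note abs_diff = indep_normal_abs_diff[OF this \<open>0 < v\<close>,
        OF noise[THEN distr_block_sum, OF Q(1) \<open>1 < n\<close>, folded s_def, folded v_def]]
    show ?thesis
      using abs_diff mult_left_mono[OF sv, of "2 / sqrt pi"] by (simp add: mult.assoc)
  qed simp
  then show "integrable M (\<lambda>\<omega>. \<bar>\<Sum>x\<in>Q. \<epsilon>\<mu> x \<omega> - \<epsilon>\<nu> x \<omega>\<bar>)"
    "expectation (\<lambda>\<omega>. \<bar>\<Sum>x\<in>Q. \<epsilon>\<mu> x \<omega> - \<epsilon>\<nu> x \<omega>\<bar>) \<le> 2 / sqrt pi * \<sigma> * sqrt (card Q)"
    by (simp_all add: sum_subtractf)
qed

section \<open>Signed discrepancy and flows\<close>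

lemma couplings_eq: "couplings n \<alpha> \<beta> = transport_plans (pixel_grid n) \<alpha> \<beta>"
  by (simp add: couplings_def transport_plans_def)

lemma wasserstein_eq:
  "wasserstein n p \<alpha> \<beta> = optimal_cost (pixel_grid n) (\<lambda>x y. torus_dist x y ^ p) \<alpha> \<beta> powr (1 / real p)"
  by (simp add: wasserstein_def optimal_cost_def transport_cost_def couplings_eq)

lemma wasserstein_1_eq:
  assumes "\<And>x. x \<in> pixel_grid n \<Longrightarrow> 0 \<le> \<alpha> x" "\<And>x. x \<in> pixel_grid n \<Longrightarrow> 0 \<le> \<beta> x"
    and "sum \<alpha> (pixel_grid n) = sum \<beta> (pixel_grid n)"
  shows "wasserstein n 1 \<alpha> \<beta> = optimal_cost (pixel_grid n) torus_dist \<alpha> \<beta>"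
  using optimal_cost_nonneg[of "pixel_grid n" torus_dist \<alpha> \<beta>] assms
  by (simp add: wasserstein_eq finite_pixel_grid torus_dist_nonneg)

text \<open>Only one factor of \<open>torus_dist x y ^ p\<close> is kept as a metric; the others are bounded by the diameter.\<close>

lemma optimal_cost_power_le:
  assumes \<alpha>: "\<And>x. x \<in> pixel_grid n \<Longrightarrow> 0 \<le> \<alpha> x" and \<beta>: "\<And>x. x \<in> pixel_grid n \<Longrightarrow> 0 \<le> \<beta> x"
    and flow: "flow_bound (pixel_grid n) torus_dist (\<lambda>x. \<alpha> x - \<beta> x) C"
    and "p \<ge> 1"
  shows "optimal_cost (pixel_grid n) (\<lambda>x y. torus_dist x y ^ p) \<alpha> \<beta> \<le> (sqrt 2 / 2) ^ (p - 1) * C"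
proof -
  let ?G = "pixel_grid n" and ?D = "sqrt 2 / 2 :: real"
  obtain \<pi> where \<pi>: "\<pi> \<in> transport_plans ?G \<alpha> \<beta>" "transport_cost ?G torus_dist \<pi> \<le> C"
    by (rule transport_plan_of_flow[OF finite_pixel_grid torus_dist_self _ \<alpha> \<beta> flow])
       (intro torus_dist_triangle pixel_grid_subset_unit_square, assumption+)
  have "optimal_cost ?G (\<lambda>x y. torus_dist x y ^ p) \<alpha> \<beta> \<le> transport_cost ?G (\<lambda>x y. torus_dist x y ^ p) \<pi>"
    by (intro optimal_cost_le \<pi>) (simp add: torus_dist_nonneg)
  also have "\<dots> \<le> ?D ^ (p - 1) * transport_cost ?G torus_dist \<pi>"
    unfolding transport_cost_def sum_distrib_left
  proof (intro sum_mono)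
    fix x y assume xy: "x \<in> ?G" "y \<in> ?G"
    have "torus_dist x y ^ p = torus_dist x y ^ (p - 1) * torus_dist x y"
      using \<open>p \<ge> 1\<close> by (cases p) simp_all
    also have "\<dots> \<le> ?D ^ (p - 1) * torus_dist x y"
      using torus_dist_le_diameter[OF xy] torus_dist_nonneg by (intro mult_right_mono power_mono)
    finally have "torus_dist x y ^ p * \<pi> x y \<le> ?D ^ (p - 1) * torus_dist x y * \<pi> x y"
      using transport_plansD(1)[OF \<pi>(1) xy] by (rule mult_right_mono)
    then show "torus_dist x y ^ p * \<pi> x y \<le> ?D ^ (p - 1) * (torus_dist x y * \<pi> x y)"
      by (simp add: mult.assoc)
  qed
  also have "\<dots> \<le> ?D ^ (p - 1) * C" using \<pi>(2) by (intro mult_left_mono) simp_all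
  finally show ?thesis .
qed

text \<open>An almost optimal plan from \<open>\<mu>\<close> to \<open>\<nu>\<close> is a flow with divergence \<open>\<mu> - \<nu>\<close>; it is superposed
with the flow for \<open>f\<close>.\<close>

lemma optimal_cost_perturbation:
  assumes \<alpha>: "\<And>x. x \<in> pixel_grid n \<Longrightarrow> 0 \<le> \<alpha> x" and \<beta>: "\<And>x. x \<in> pixel_grid n \<Longrightarrow> 0 \<le> \<beta> x"
    and \<mu>: "\<And>x. x \<in> pixel_grid n \<Longrightarrow> 0 \<le> \<mu> x" and \<nu>: "\<And>x. x \<in> pixel_grid n \<Longrightarrow> 0 \<le> \<nu> x"
    and balanced: "sum \<mu> (pixel_grid n) = sum \<nu> (pixel_grid n)"
    and diff: "\<And>x. x \<in> pixel_grid n \<Longrightarrow> \<alpha> x - \<beta> x = \<mu> x - \<nu> x + f x"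
    and flow: "flow_bound (pixel_grid n) torus_dist f C"
    and "p \<ge> 1"
  shows "optimal_cost (pixel_grid n) (\<lambda>x y. torus_dist x y ^ p) \<alpha> \<beta>
    \<le> (sqrt 2 / 2) ^ (p - 1) * (optimal_cost (pixel_grid n) torus_dist \<mu> \<nu> + C)"
proof -
  let ?G = "pixel_grid n" and ?D = "sqrt 2 / 2 :: real"
  let ?V = "optimal_cost ?G (\<lambda>x y. torus_dist x y ^ p) \<alpha> \<beta>"
  have "?V / ?D ^ (p - 1) - C \<le> transport_cost ?G torus_dist \<pi>" if "\<pi> \<in> transport_plans ?G \<mu> \<nu>" for \<pi>
  proof -
    have "flow_bound ?G torus_dist (\<lambda>x. \<alpha> x - \<beta> x) (transport_cost ?G torus_dist \<pi> + C)"
      using flow_bound_add[OF flow_bound_plan[OF that] flow] by (rule flow_bound_cong) (simp add: diff)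
    then have "?V \<le> ?D ^ (p - 1) * (transport_cost ?G torus_dist \<pi> + C)"
      by (intro optimal_cost_power_le \<alpha> \<beta> \<open>p \<ge> 1\<close>)
    moreover have "0 < ?D ^ (p - 1)" by simp
    ultimately have "?V / ?D ^ (p - 1) \<le> transport_cost ?G torus_dist \<pi> + C"
      by (subst pos_divide_le_eq) (simp_all add: mult.commute)
    then show ?thesis by simp
  qed
  then have "?V / ?D ^ (p - 1) - C \<le> optimal_cost ?G torus_dist \<mu> \<nu>"
    unfolding optimal_cost_def[of ?G torus_dist]
    by (intro cINF_greatest transport_plans_nonempty finite_pixel_grid \<mu> \<nu> balanced)
  then have "?V / ?D ^ (p - 1) \<le> optimal_cost ?G torus_dist \<mu> \<nu> + C" by simp
  moreover have "0 < ?D ^ (p - 1)" by simp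
  ultimately show ?thesis
    by (subst (asm) pos_divide_le_eq) (simp_all add: mult.commute)
qed

section \<open>Dyadic transport of the noise\<close>

text \<open>The cost of the hierarchical flow of \<open>flow_bound_hierarchy\<close> along the dyadic blocks, up to the block
that is the whole grid.\<close>

definition dyadic_cost :: "nat \<Rightarrow> (pixel \<Rightarrow> real) \<Rightarrow> real" where
  "dyadic_cost \<eta> f = (\<Sum>k<\<eta>. \<Sum>u\<in>snap_pixel (2 ^ \<eta>) k ` pixel_grid (2 ^ \<eta>).
     \<bar>\<Sum>z | z \<in> pixel_grid (2 ^ \<eta>) \<and> snap_pixel (2 ^ \<eta>) k z = u. f z\<bar>
       * torus_dist u (snap_pixel (2 ^ \<eta>) (Suc k) u))"

lemma dyadic_cost_nonneg: "0 \<le> dyadic_cost \<eta> f"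
  unfolding dyadic_cost_def by (intro sum_nonneg mult_nonneg_nonneg torus_dist_nonneg) simp

lemma flow_bound_dyadic_cost:
  assumes "sum f (pixel_grid (2 ^ \<eta>)) = 0"
  shows "flow_bound (pixel_grid (2 ^ \<eta>)) torus_dist f (dyadic_cost \<eta> f)"
  unfolding dyadic_cost_def
  by (rule flow_bound_hierarchy)
     (use assms in \<open>auto intro: torus_dist_commute simp: finite_pixel_grid snap_pixel_in_grid
        snap_pixel_Suc_snap_pixel snap_pixel_bottom snap_pixel_top\<close>)

text \<open>The three powers of two at level \<open>k\<close>, namely \<open>4 ^ (\<eta> - k)\<close> blocks, standard deviation of order
\<open>2 ^ k\<close> and distance of order \<open>2 ^ k / n\<close>, multiply to \<open>n\<close>: all levels contribute equally, and
their number gives the logarithm.\<close>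

lemma (in prob_space) dyadic_cost_noise:
  assumes "n = 2 ^ \<eta>" "1 \<le> \<eta>" "0 < \<sigma>"
    and noise: "zero_sum_gaussian_noise M n \<sigma> \<epsilon>\<mu>" "zero_sum_gaussian_noise M n \<sigma> \<epsilon>\<nu>"
    and indep: "indep_var (PiM (pixel_grid n) (\<lambda>_. borel)) (\<lambda>\<omega>. \<lambda>x\<in>pixel_grid n. \<epsilon>\<mu> x \<omega>)
           (PiM (pixel_grid n) (\<lambda>_. borel)) (\<lambda>\<omega>. \<lambda>x\<in>pixel_grid n. \<epsilon>\<nu> x \<omega>)"
  shows "integrable M (\<lambda>\<omega>. dyadic_cost \<eta> (\<lambda>x. \<epsilon>\<mu> x \<omega> - \<epsilon>\<nu> x \<omega>))"
    and "expectation (\<lambda>\<omega>. dyadic_cost \<eta> (\<lambda>x. \<epsilon>\<mu> x \<omega> - \<epsilon>\<nu> x \<omega>))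
      \<le> 2 * sqrt 2 / sqrt pi * (real n * real \<eta>) * \<sigma>"
proof -
  let ?B = "\<lambda>k u. {z. z \<in> pixel_grid n \<and> snap_pixel n k z = u}"
  let ?U = "\<lambda>k. snap_pixel n k ` pixel_grid n"
  let ?S = "\<lambda>k u \<omega>. \<bar>\<Sum>z\<in>?B k u. \<epsilon>\<mu> z \<omega> - \<epsilon>\<nu> z \<omega>\<bar>"
  have "1 < n" using \<open>1 \<le> \<eta>\<close> one_less_power[of "2::nat" \<eta>] by (simp add: \<open>n = 2 ^ \<eta>\<close>)
  have block: "integrable M (?S k u)"
    "expectation (?S k u) \<le> 2 / sqrt pi * \<sigma> * 2 ^ k" if "k < \<eta>" for k u
  proof -
    have small: "card (?B k u) \<le> 4 ^ k" by (rule card_snap_pixel_fiber_le)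
    have "(4::nat) ^ k < 4 ^ \<eta>" using that by simp
    also have "(4::nat) ^ \<eta> = n\<^sup>2"
      unfolding \<open>n = 2 ^ \<eta>\<close> by (simp add: power2_eq_square flip: power_mult_distrib)
    finally have "card (?B k u) < n\<^sup>2" using small by simp
    note diff = block_noise_difference[OF noise indep \<open>0 < \<sigma>\<close> \<open>1 < n\<close> _ this]
    show "integrable M (?S k u)" by (rule diff(1)) auto
    have "real (card (?B k u)) \<le> 4 ^ k" using small by (metis of_nat_le_iff of_nat_numeral of_nat_power)
    then have "sqrt (card (?B k u)) \<le> sqrt (4 ^ k)" by (rule real_sqrt_le_mono)
    also have "sqrt (4 ^ k) = 2 ^ k" by (simp add: real_sqrt_power)
    finally have "2 / sqrt pi * \<sigma> * sqrt (card (?B k u)) \<le> 2 / sqrt pi * \<sigma> * 2 ^ k"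
      using \<open>0 < \<sigma>\<close> by (intro mult_left_mono) auto
    moreover have "expectation (?S k u) \<le> 2 / sqrt pi * \<sigma> * sqrt (card (?B k u))" by (rule diff(2)) auto
    ultimately show "expectation (?S k u) \<le> 2 / sqrt pi * \<sigma> * 2 ^ k" by (rule order_trans[rotated])
  qed
  have cost: "dyadic_cost \<eta> (\<lambda>x. \<epsilon>\<mu> x \<omega> - \<epsilon>\<nu> x \<omega>) =
      (\<Sum>k<\<eta>. \<Sum>u\<in>?U k. ?S k u \<omega> * torus_dist u (snap_pixel n (Suc k) u))" for \<omega>
    by (simp add: dyadic_cost_def \<open>n = 2 ^ \<eta>\<close>)
  show "integrable M (\<lambda>\<omega>. dyadic_cost \<eta> (\<lambda>x. \<epsilon>\<mu> x \<omega> - \<epsilon>\<nu> x \<omega>))"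
    unfolding cost using block by (intro Bochner_Integration.integrable_sum integrable_mult_left) auto
  have "expectation (\<lambda>\<omega>. dyadic_cost \<eta> (\<lambda>x. \<epsilon>\<mu> x \<omega> - \<epsilon>\<nu> x \<omega>)) =
      (\<Sum>k<\<eta>. \<Sum>u\<in>?U k. expectation (?S k u) * torus_dist u (snap_pixel n (Suc k) u))"
    unfolding cost using block
    by (subst Bochner_Integration.integral_sum,
        intro Bochner_Integration.integrable_sum integrable_mult_left, simp,
        intro sum.cong refl, subst Bochner_Integration.integral_sum) auto
  also have "\<dots> \<le> (\<Sum>k<\<eta>. \<Sum>u\<in>?U k. 2 / sqrt pi * \<sigma> * 2 ^ k * (sqrt 2 * (2 ^ k / real n)))"
    using block \<open>0 < \<sigma>\<close>
    by (intro sum_mono mult_mono torus_dist_snap_pixel_Suc_le torus_dist_nonneg) auto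
  also have "\<dots> \<le> (\<Sum>k<\<eta>. 2 * sqrt 2 / sqrt pi * \<sigma> * real n)"
  proof (intro sum_mono)
    fix k assume "k \<in> {..<\<eta>}"
    then have "k \<le> \<eta>" by simp
    then have "card (?U k) \<le> 4 ^ (\<eta> - k)" unfolding \<open>n = 2 ^ \<eta>\<close> by (rule card_snap_pixel_image_le)
    then have "real (card (?U k)) \<le> 4 ^ (\<eta> - k)" by (metis of_nat_le_iff of_nat_numeral of_nat_power)
    then have "real (card (?U k)) * 4 ^ k \<le> 4 ^ (\<eta> - k) * 4 ^ k" by (rule mult_right_mono) simp
    also have "(4::real) ^ (\<eta> - k) * 4 ^ k = 4 ^ \<eta>" using \<open>k \<le> \<eta>\<close> by (simp flip: power_add)
    also have "\<dots> = real n * real n" unfolding \<open>n = 2 ^ \<eta>\<close> by (simp flip: power_mult_distrib)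
    finally have "real (card (?U k)) * 4 ^ k / real n \<le> real n"
      using \<open>1 < n\<close> by (simp add: pos_divide_le_eq)
    then have "2 * sqrt 2 / sqrt pi * \<sigma> * (real (card (?U k)) * 4 ^ k / real n) \<le> 2 * sqrt 2 / sqrt pi * \<sigma> * real n"
      using \<open>0 < \<sigma>\<close> by (intro mult_left_mono) auto
    moreover have "(4::real) ^ k = 2 ^ k * 2 ^ k" by (simp flip: power_mult_distrib)
    ultimately show "(\<Sum>u\<in>?U k. 2 / sqrt pi * \<sigma> * 2 ^ k * (sqrt 2 * (2 ^ k / real n)))
        \<le> 2 * sqrt 2 / sqrt pi * \<sigma> * real n"
      by (simp add: mult_ac)
  qed
  also have "\<dots> = 2 * sqrt 2 / sqrt pi * (real n * real \<eta>) * \<sigma>" by simp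
  finally show "expectation (\<lambda>\<omega>. dyadic_cost \<eta> (\<lambda>x. \<epsilon>\<mu> x \<omega> - \<epsilon>\<nu> x \<omega>))
      \<le> 2 * sqrt 2 / sqrt pi * (real n * real \<eta>) * \<sigma>" .
qed

section \<open>The expected discrepancy\<close>

lemma powr_add_le:
  fixes x y \<theta> :: real
  assumes "0 \<le> x" "0 \<le> y" "0 < \<theta>" "\<theta> \<le> 1"
  shows "(x + y) powr \<theta> \<le> x powr \<theta> + y powr \<theta>"
proof (cases "x + y = 0")
  case False
  then have pos: "0 < x + y" using assms by simp
  have ge: "t \<le> t powr \<theta>" if "0 \<le> t" "t \<le> 1" for t :: real
    using powr_mono'[of \<theta> 1 t] that assms by simp
  have "1 = x / (x + y) + y / (x + y)" using False by (simp add: add_divide_distrib[symmetric])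
  also have "\<dots> \<le> (x / (x + y)) powr \<theta> + (y / (x + y)) powr \<theta>"
    using assms pos by (intro add_mono ge) auto
  also have "\<dots> = (x powr \<theta> + y powr \<theta>) / (x + y) powr \<theta>"
    using assms by (simp add: powr_divide add_divide_distrib)
  finally show ?thesis using pos by (simp add: pos_le_divide_eq)
qed (use assms in simp)

text \<open>The right-hand side is the tangent of \<open>x powr \<theta>\<close> at \<open>a\<close>. Being affine in \<open>x\<close>, it can be integrated,
and it takes the value \<open>a powr \<theta>\<close> at \<open>a\<close>: this is Jensen's inequality for concave powers, in a form
that also applies when \<open>a\<close> is only an upper bound of the mean.\<close>

lemma powr_le_tangent:
  fixes x a \<theta> :: real
  assumes "0 \<le> x" "0 < a" "0 < \<theta>" "\<theta> \<le> 1"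
  shows "x powr \<theta> \<le> a powr (\<theta> - 1) * (\<theta> * x + (1 - \<theta>) * a)"
proof (cases "x = 0")
  case False
  have "x powr \<theta> = a powr (\<theta> - 1) * (x powr \<theta> * a powr (1 - \<theta>))"
    using \<open>0 < a\<close> by (simp add: mult.left_commute flip: powr_add)
  also have "\<dots> \<le> a powr (\<theta> - 1) * (\<theta> * x + (1 - \<theta>) * a)"
    using assms False by (intro mult_left_mono Youngs_inequality_0) auto
  finally show ?thesis .
qed (use assms in simp)

theorem theorem3p8:
  fixes M :: "'w measure"
    and \<eta> n p :: nat
    and \<sigma> :: real
    and \<mu> \<nu> :: "pixel \<Rightarrow> real"
    and \<epsilon>\<mu> \<epsilon>\<nu> :: "pixel \<Rightarrow> 'w \<Rightarrow> real"
  assumes "prob_space M"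
    and "\<eta> \<ge> 1" and "n = 2 ^ \<eta>"
    and "p > 1"
    and "\<sigma> > 0"
    and "\<And>x. x \<in> pixel_grid n \<Longrightarrow> \<mu> x \<in> {0..1}" and "(\<Sum>x\<in>pixel_grid n. \<mu> x) = 1"
    and "\<And>x. x \<in> pixel_grid n \<Longrightarrow> \<nu> x \<in> {0..1}" and "(\<Sum>x\<in>pixel_grid n. \<nu> x) = 1"
    and "zero_sum_gaussian_noise M n \<sigma> \<epsilon>\<mu>"
    and "zero_sum_gaussian_noise M n \<sigma> \<epsilon>\<nu>"
    and "prob_space.indep_var M
           (PiM (pixel_grid n) (\<lambda>_. borel)) (\<lambda>\<omega>. \<lambda>x\<in>pixel_grid n. \<epsilon>\<mu> x \<omega>)
           (PiM (pixel_grid n) (\<lambda>_. borel)) (\<lambda>\<omega>. \<lambda>x\<in>pixel_grid n. \<epsilon>\<nu> x \<omega>)"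
  shows "integrable M
           (\<lambda>\<omega>. signed_wasserstein n p (\<lambda>x. \<mu> x + \<epsilon>\<mu> x \<omega>) (\<lambda>x. \<nu> x + \<epsilon>\<nu> x \<omega>)) \<and>
         prob_space.expectation M
           (\<lambda>\<omega>. signed_wasserstein n p (\<lambda>x. \<mu> x + \<epsilon>\<mu> x \<omega>) (\<lambda>x. \<nu> x + \<epsilon>\<nu> x \<omega>))
         \<le> (sqrt 2 / 2) powr (1 - 1 / real p) * wasserstein n 1 \<mu> \<nu> powr (1 / real p)
           + sqrt 2 / 2
             * (4 / sqrt pi * real n * log 2 (real n) + 1 / sqrt pi * real n) powr (1 / real p)
             * \<sigma> powr (1 / real p)"
proof -
  interpret prob_space M by fact
  let ?G = "pixel_grid n"
  define \<theta> where "\<theta> = 1 / real p"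
  define D where "D = sqrt 2 / (2 :: real)"
  define N where "N \<omega> = dyadic_cost \<eta> (\<lambda>x. \<epsilon>\<mu> x \<omega> - \<epsilon>\<nu> x \<omega>)" for \<omega>
  define a where "a = 2 * sqrt 2 / sqrt pi * (real n * real \<eta>) * \<sigma>"
  define W where "W = wasserstein n 1 \<mu> \<nu>"
  let ?\<rho> = "\<lambda>\<omega> x. \<mu> x + \<epsilon>\<mu> x \<omega>" and ?\<tau> = "\<lambda>\<omega> x. \<nu> x + \<epsilon>\<nu> x \<omega>"
  let ?\<alpha> = "\<lambda>\<omega> x. max (?\<rho> \<omega> x) 0 + max (- ?\<tau> \<omega> x) 0"
  let ?\<beta> = "\<lambda>\<omega> x. max (?\<tau> \<omega> x) 0 + max (- ?\<rho> \<omega> x) 0"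
  let ?SW = "\<lambda>\<omega>. signed_wasserstein n p (?\<rho> \<omega>) (?\<tau> \<omega>)"
  have "1 < n" using \<open>\<eta> \<ge> 1\<close> one_less_power[of "2::nat" \<eta>] by (simp add: \<open>n = 2 ^ \<eta>\<close>)
  have \<theta>: "0 < \<theta>" "\<theta> \<le> 1" using \<open>p > 1\<close> by (simp_all add: \<theta>_def)
  have "0 < D" by (simp add: D_def)
  have "0 < a" using \<open>1 < n\<close> \<open>\<eta> \<ge> 1\<close> \<open>\<sigma> > 0\<close> by (simp add: a_def)
  have N0: "0 \<le> N \<omega>" for \<omega> unfolding N_def by (rule dyadic_cost_nonneg)
  have N_int: "integrable M N" and N_le: "expectation N \<le> a"
    unfolding N_def[abs_def] a_def
    by (rule dyadic_cost_noise[OF \<open>n = 2 ^ \<eta>\<close> \<open>\<eta> \<ge> 1\<close> \<open>\<sigma> > 0\<close> assms(10-12)])+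
  have \<mu>0: "0 \<le> \<mu> x" and \<nu>0: "0 \<le> \<nu> x" if "x \<in> ?G" for x
    using assms(6,8) that by auto
  have balanced: "sum \<mu> ?G = sum \<nu> ?G" using assms(7,9) by simp
  have W_eq: "W = optimal_cost ?G torus_dist \<mu> \<nu>"
    unfolding W_def by (intro wasserstein_1_eq \<mu>0 \<nu>0 balanced)
  have W0: "0 \<le> W" by (simp add: W_def wasserstein_eq)
  have SW_eq: "?SW \<omega> = optimal_cost ?G (\<lambda>x y. torus_dist x y ^ p) (?\<alpha> \<omega>) (?\<beta> \<omega>) powr \<theta>" for \<omega>
    by (simp add: signed_wasserstein_def wasserstein_eq \<theta>_def)
  have SW_meas: "?SW \<in> borel_measurable M"
  proof -
    have [measurable]: "\<epsilon>\<mu> x \<in> borel_measurable M" "\<epsilon>\<nu> x \<in> borel_measurable M" if "x \<in> ?G" for x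
      using that assms(10,11) by (auto intro: measurable_noise)
    have "(\<lambda>\<omega>. optimal_cost ?G (\<lambda>x y. torus_dist x y ^ p) (?\<alpha> \<omega>) (?\<beta> \<omega>)) \<in> borel_measurable M"
    proof (rule borel_measurable_optimal_cost[OF finite_pixel_grid])
      fix x y assume xy: "x \<in> ?G" "y \<in> ?G"
      have "sqrt 2 / 2 \<le> (1 :: real)" using sqrt2_less_2 by simp
      then have "torus_dist x y \<le> 1" using torus_dist_le_diameter[OF xy] by linarith
      then show "torus_dist x y ^ p \<le> 1" by (intro power_le_one torus_dist_nonneg)
    qed (simp_all add: torus_dist_nonneg)
    then show ?thesis unfolding SW_eq by simp
  qed
  \<comment> \<open>An integrable function of the noise: the \<open>p\<close>-th root of the flow cost is replaced by its tangent
    at the bound \<open>a\<close> of the mean flow cost.\<close>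
  define B where "B \<omega> = D powr (1 - \<theta>) * (W powr \<theta> + a powr (\<theta> - 1) * (\<theta> * N \<omega> + (1 - \<theta>) * a))" for \<omega>
  have bound: "?SW \<omega> \<le> B \<omega>"
    if "(\<Sum>x\<in>?G. \<epsilon>\<mu> x \<omega>) = 0" "(\<Sum>x\<in>?G. \<epsilon>\<nu> x \<omega>) = 0" for \<omega>
  proof -
    let ?V = "optimal_cost ?G (\<lambda>x y. torus_dist x y ^ p) (?\<alpha> \<omega>) (?\<beta> \<omega>)"
    have diff: "?\<alpha> \<omega> x - ?\<beta> \<omega> x = \<mu> x - \<nu> x + (\<epsilon>\<mu> x \<omega> - \<epsilon>\<nu> x \<omega>)" for x
      by (simp add: max_def)
    have "(\<Sum>x\<in>?G. ?\<alpha> \<omega> x - ?\<beta> \<omega> x) = 0"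
      unfolding diff using that balanced by (simp add: sum.distrib sum_subtractf)
    then have "sum (?\<alpha> \<omega>) ?G = sum (?\<beta> \<omega>) ?G" by (simp add: sum_subtractf)
    then have V0: "0 \<le> ?V"
      by (intro optimal_cost_nonneg finite_pixel_grid) (simp_all add: torus_dist_nonneg)
    have "flow_bound ?G torus_dist (\<lambda>x. \<epsilon>\<mu> x \<omega> - \<epsilon>\<nu> x \<omega>) (N \<omega>)"
      using flow_bound_dyadic_cost[of "\<lambda>x. \<epsilon>\<mu> x \<omega> - \<epsilon>\<nu> x \<omega>" \<eta>] that
      by (simp add: N_def \<open>n = 2 ^ \<eta>\<close> sum_subtractf)
    then have "?V \<le> D ^ (p - 1) * (W + N \<omega>)"
      unfolding D_def W_eq using \<open>p > 1\<close>
      by (intro optimal_cost_perturbation[OF _ _ \<mu>0 \<nu>0 balanced diff]) auto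
    then have "?V powr \<theta> \<le> (D ^ (p - 1) * (W + N \<omega>)) powr \<theta>"
      using V0 \<theta> by (intro powr_mono2) auto
    also have "\<dots> = (D ^ (p - 1)) powr \<theta> * (W + N \<omega>) powr \<theta>"
      by (rule powr_mult)
    also have "(D ^ (p - 1)) powr \<theta> = D powr (1 - \<theta>)"
    proof -
      have "real (p - 1) * \<theta> = 1 - \<theta>" using \<open>p > 1\<close> by (simp add: \<theta>_def of_nat_diff field_simps)
      then show ?thesis using \<open>0 < D\<close> by (simp add: powr_powr flip: powr_realpow)
    qed
    also have "D powr (1 - \<theta>) * (W + N \<omega>) powr \<theta> \<le> D powr (1 - \<theta>) * (W powr \<theta> + N \<omega> powr \<theta>)"
      by (intro mult_left_mono powr_add_le W0 N0 \<theta>) simp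
    also have "\<dots> \<le> B \<omega>"
      unfolding B_def by (intro mult_left_mono add_left_mono powr_le_tangent N0 \<open>0 < a\<close> \<theta>) simp
    finally show ?thesis unfolding SW_eq .
  qed
  have AE_bound: "AE \<omega> in M. ?SW \<omega> \<le> B \<omega>"
    using AE_noise_sum_zero[OF assms(10) \<open>1 < n\<close>] AE_noise_sum_zero[OF assms(11) \<open>1 < n\<close>]
    by eventually_elim (rule bound)
  have B_int: "integrable M B" unfolding B_def[abs_def] using N_int by simp
  have SW_int: "integrable M ?SW"
  proof (rule Bochner_Integration.integrable_bound[OF B_int SW_meas])
    show "AE \<omega> in M. norm (?SW \<omega>) \<le> norm (B \<omega>)"
      using AE_bound by eventually_elim (auto simp: SW_eq)
  qed
  have "expectation ?SW \<le> expectation B"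
    using SW_int B_int AE_bound by (rule integral_mono_AE)
  also have "expectation B = D powr (1 - \<theta>) * (W powr \<theta> + a powr (\<theta> - 1) * (\<theta> * expectation N + (1 - \<theta>) * a))"
    unfolding B_def[abs_def] using N_int by (simp add: prob_space)
  also have "\<dots> \<le> D powr (1 - \<theta>) * (W powr \<theta> + a powr (\<theta> - 1) * (\<theta> * a + (1 - \<theta>) * a))"
    using N_le \<theta> by (intro mult_left_mono add_left_mono add_right_mono) auto
  also have "a powr (\<theta> - 1) * (\<theta> * a + (1 - \<theta>) * a) = a powr \<theta>"
    using \<open>0 < a\<close> by (simp add: algebra_simps powr_diff)
  also have "D powr (1 - \<theta>) * (W powr \<theta> + a powr \<theta>) = D powr (1 - \<theta>) * W powr \<theta> + D * (a / D) powr \<theta>"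
    using \<open>0 < D\<close> \<open>0 < a\<close> by (simp add: powr_divide powr_diff field_simps)
  also have "\<dots> \<le> D powr (1 - \<theta>) * W powr \<theta>
      + D * ((4 / sqrt pi * real n * log 2 (real n) + 1 / sqrt pi * real n) * \<sigma>) powr \<theta>"
  proof -
    have "a / D = 4 / sqrt pi * real n * real \<eta> * \<sigma>" by (simp add: a_def D_def)
    also have "real \<eta> = log 2 (real n)" by (simp add: \<open>n = 2 ^ \<eta>\<close> log_nat_power)
    also have "4 / sqrt pi * real n * log 2 (real n) * \<sigma>
        \<le> (4 / sqrt pi * real n * log 2 (real n) + 1 / sqrt pi * real n) * \<sigma>"
      using \<open>\<sigma> > 0\<close> by (intro mult_right_mono) auto
    finally show ?thesis
      using \<open>0 < a\<close> \<open>0 < D\<close> \<theta> by (intro add_left_mono mult_left_mono powr_mono2) auto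
  qed
  also have "((4 / sqrt pi * real n * log 2 (real n) + 1 / sqrt pi * real n) * \<sigma>) powr \<theta>
      = (4 / sqrt pi * real n * log 2 (real n) + 1 / sqrt pi * real n) powr \<theta> * \<sigma> powr \<theta>"
    by (rule powr_mult)
  finally show ?thesis
    using SW_int unfolding D_def W_def \<theta>_def by (simp add: mult.assoc)
qed

end
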